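(* The $6$-element semigroup $AC_2$ has no finite identity basis (that is, there is no finite set $\Sigma$ of identities holding in $AC_2$ such that every identity holding in $AC_2$ follows from $\Sigma$). Nevertheless, there is an algorithm which, given an arbitrary finite semigroup $S$, decides in $O(|S|^3)$ time whether or not $S$ belongs to the variety $\operatorname{var} AC_2$ generated by $AC_2$.
   Context: The semigroup $A_2$ is the 5-element semigroup defined, in the class of semigroups with zero, by the presentation $A_2=\langle a,b\mid a^2=aba=a,\ bab=b,\ b^2=0\rangle=\{a,b,ab,ba,0\}$. The semigroup $AC_2$ is the 6-element set $A_2\cup\{c\}$ with $c\notin A_2$, whose multiplication extends that of $A_2$ by the rules $c^2=0$ and $xc=cx=c$ for all $x\in A_2$ (so $0$ is not a zero of $AC_2$, since $0c=c0=c$). For a semigroup $B$, $\operatorname{var} B$ denotes the variety of semigroups generated by $B$, i.e. the class of all semigroups satisfying every semigroup identity that holds in $B$. An identity is a pair $u=v$ of non-empty words over a countably infinite alphabet of variables; it follows from a set $\Sigma$ of identities if it holds in every semigroup that satisfies all identities in $\Sigma$. The decision problem has $B=AC_2$ fixed: an instance is a finite semigroup $S$, given by its multiplication table, and the answer is YES if $S\in\operatorname{var} B$ and NO otherwise. Time is the number of elementary steps of a deterministic algorithm, where looking up a product of two elements of $S$ counts as one elementary step. *)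

theory Defs
  imports Complex_Main "HOL-Library.Countable_Set" "HOL-Library.Landau_Symbols"
begin

section \<open>Semigroups, identities and varieties\<close>

definition semigroup_on :: "'a set \<Rightarrow> ('a \<Rightarrow> 'a \<Rightarrow> 'a) \<Rightarrow> bool" where
  "semigroup_on S f \<longleftrightarrow> S \<noteq> {} \<and> (\<forall>x\<in>S. \<forall>y\<in>S. f x y \<in> S) \<and>
     (\<forall>x\<in>S. \<forall>y\<in>S. \<forall>z\<in>S. f (f x y) z = f x (f y z))"

text \<open>Variables are natural numbers and words are lists of variables.\<close>

type_synonym identity = "nat list \<times> nat list"

definition is_identity :: "identity \<Rightarrow> bool" where
  "is_identity e \<longleftrightarrow> fst e \<noteq> [] \<and> snd e \<noteq> []"

text \<open>The value on the empty word is irrelevant: identities consist of non-empty words.\<close>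

fun word_value :: "('a \<Rightarrow> 'a \<Rightarrow> 'a) \<Rightarrow> (nat \<Rightarrow> 'a) \<Rightarrow> nat list \<Rightarrow> 'a" where
  "word_value f \<phi> [] = undefined"
| "word_value f \<phi> [x] = \<phi> x"
| "word_value f \<phi> (x # y # w) = f (\<phi> x) (word_value f \<phi> (y # w))"

definition satisfies :: "'a set \<Rightarrow> ('a \<Rightarrow> 'a \<Rightarrow> 'a) \<Rightarrow> identity \<Rightarrow> bool" where
  "satisfies S f e \<longleftrightarrow>
     (\<forall>\<phi>. range \<phi> \<subseteq> S \<longrightarrow> word_value f \<phi> (fst e) = word_value f \<phi> (snd e))"

definition in_variety ::
    "'a set \<Rightarrow> ('a \<Rightarrow> 'a \<Rightarrow> 'a) \<Rightarrow> 'b set \<Rightarrow> ('b \<Rightarrow> 'b \<Rightarrow> 'b) \<Rightarrow> bool" where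
  "in_variety S f B g \<longleftrightarrow> semigroup_on S f \<and>
     (\<forall>e. is_identity e \<and> satisfies B g e \<longrightarrow> satisfies S f e)"

text \<open>
  A definition cannot quantify over types, so consequence is defined through the semigroups whose
  elements are natural numbers. As \<open>follows_satisfies\<close> below shows, this covers the semigroups
  over every type: a failing identity already fails in a countable subsemigroup.
\<close>

definition follows :: "identity set \<Rightarrow> identity \<Rightarrow> bool" where
  "follows \<Sigma> e \<longleftrightarrow>
     (\<forall>(S :: nat set) f. semigroup_on S f \<and> (\<forall>d\<in>\<Sigma>. satisfies S f d) \<longrightarrow> satisfies S f e)"

definition identity_basis :: "identity set \<Rightarrow> 'b set \<Rightarrow> ('b \<Rightarrow> 'b \<Rightarrow> 'b) \<Rightarrow> bool" where
  "identity_basis \<Sigma> B g \<longleftrightarrow>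
     (\<forall>e\<in>\<Sigma>. is_identity e \<and> satisfies B g e) \<and>
     (\<forall>e. is_identity e \<and> satisfies B g e \<longrightarrow> follows \<Sigma> e)"

definition finitely_based :: "'b set \<Rightarrow> ('b \<Rightarrow> 'b \<Rightarrow> 'b) \<Rightarrow> bool" where
  "finitely_based B g \<longleftrightarrow> (\<exists>\<Sigma>. finite \<Sigma> \<and> identity_basis \<Sigma> B g)"

lemma word_value_Cons:
  "w \<noteq> [] \<Longrightarrow> word_value f \<phi> (x # w) = f (\<phi> x) (word_value f \<phi> w)"
  by (cases w) auto

lemma word_value_closed:
  assumes "semigroup_on S f" "range \<phi> \<subseteq> S" "w \<noteq> []"
  shows "word_value f \<phi> w \<in> S"
  using assms(3)
proof (induction w rule: list_nonempty_induct)
  case (single x)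
  then show ?case using assms by auto
next
  case (cons x w)
  then show ?case using assms by (auto simp: word_value_Cons semigroup_on_def)
qed

lemma word_value_append:
  assumes "semigroup_on S f" "range \<phi> \<subseteq> S" "v \<noteq> []" "w \<noteq> []"
  shows "word_value f \<phi> (v @ w) = f (word_value f \<phi> v) (word_value f \<phi> w)"
  using assms(3)
proof (induction v rule: list_nonempty_induct)
  case (single x)
  then show ?case using assms by (auto simp: word_value_Cons)
next
  case (cons x v)
  have "\<phi> x \<in> S" "word_value f \<phi> v \<in> S" "word_value f \<phi> w \<in> S"
    using assms cons word_value_closed[OF assms(1,2)] by auto
  then show ?case using assms cons by (auto simp: word_value_Cons semigroup_on_def)
qed

lemma word_value_hom:
  assumes "semigroup_on S f" "range \<phi> \<subseteq> S" "w \<noteq> []"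
    and "\<And>x y. x \<in> S \<Longrightarrow> y \<in> S \<Longrightarrow> h (f x y) = g (h x) (h y)"
  shows "h (word_value f \<phi> w) = word_value g (h \<circ> \<phi>) w"
  using assms(3)
proof (induction w rule: list_nonempty_induct)
  case (single x)
  then show ?case by simp
next
  case (cons x w)
  have "\<phi> x \<in> S" "word_value f \<phi> w \<in> S"
    using assms cons word_value_closed[OF assms(1,2)] by auto
  then show ?case using assms(4) cons by (simp add: word_value_Cons)
qed

lemma follows_satisfies:
  fixes S :: "'a set"
  assumes fol: "follows \<Sigma> e" and e: "is_identity e" and \<Sigma>: "\<forall>d\<in>\<Sigma>. is_identity d"
    and S: "semigroup_on S f" and sat: "\<forall>d\<in>\<Sigma>. satisfies S f d"
  shows "satisfies S f e"
  unfolding satisfies_def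
proof (intro allI impI)
  fix \<phi> :: "nat \<Rightarrow> 'a" assume \<phi>: "range \<phi> \<subseteq> S"
  define W where "W = word_value f \<phi> ` {w. w \<noteq> []}"
  have cW: "countable W" unfolding W_def by (intro countable_image) simp
  have WS: "W \<subseteq> S" using word_value_closed[OF S \<phi>] by (auto simp: W_def)
  have closed: "f x y \<in> W" if xy: "x \<in> W" "y \<in> W" for x y
  proof -
    obtain v w where "x = word_value f \<phi> v" "y = word_value f \<phi> w" "v \<noteq> []" "w \<noteq> []"
      using xy by (auto simp: W_def)
    then show ?thesis
      using word_value_append[OF S \<phi>, of v w] by (auto simp: W_def intro!: image_eqI[of _ _ "v @ w"])
  qed
  have \<phi>W: "range \<phi> \<subseteq> W" by (auto simp: W_def intro!: image_eqI[of _ _ "[_]"])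
  define g where "g = to_nat_on W"
  define h where "h = from_nat_into W"
  have hg: "h (g x) = x" if "x \<in> W" for x
    using that cW by (simp add: g_def h_def)
  define f' where "f' = (\<lambda>x y. g (f (h x) (h y)))"
  have Wne: "W \<noteq> {}" using \<phi>W by auto
  have semW: "semigroup_on W f" using S WS closed Wne unfolding semigroup_on_def by blast
  have sem: "semigroup_on (g ` W) f'"
    using Wne closed semW unfolding semigroup_on_def f'_def by (simp add: hg)
  have hhom: "h (f' x y) = f (h x) (h y)" if "x \<in> g ` W" "y \<in> g ` W" for x y
    using that closed by (auto simp: f'_def hg)
  have ghom: "g (f x y) = f' (g x) (g y)" if "x \<in> W" "y \<in> W" for x y
    using that by (auto simp: f'_def hg)
  have "satisfies (g ` W) f' d" if "d \<in> \<Sigma>" for d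
    unfolding satisfies_def
  proof (intro allI impI)
    fix \<psi> :: "nat \<Rightarrow> nat" assume \<psi>: "range \<psi> \<subseteq> g ` W"
    have h\<psi>: "range (h \<circ> \<psi>) \<subseteq> W"
    proof
      fix y assume "y \<in> range (h \<circ> \<psi>)"
      then obtain n where "y = h (\<psi> n)" by auto
      moreover have "\<psi> n \<in> g ` W" using \<psi> by auto
      ultimately show "y \<in> W" by (auto simp: hg)
    qed
    have ne: "fst d \<noteq> []" "snd d \<noteq> []" using \<Sigma> that by (auto simp: is_identity_def)
    have "word_value f (h \<circ> \<psi>) (fst d) = word_value f (h \<circ> \<psi>) (snd d)"
      using sat that h\<psi> WS by (force simp: satisfies_def)
    then have "h (word_value f' \<psi> (fst d)) = h (word_value f' \<psi> (snd d))"
      using word_value_hom[where h = h, OF sem \<psi> _ hhom] ne by simp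
    moreover have "word_value f' \<psi> (fst d) \<in> g ` W" "word_value f' \<psi> (snd d) \<in> g ` W"
      using word_value_closed[OF sem \<psi>] ne by auto
    ultimately show "word_value f' \<psi> (fst d) = word_value f' \<psi> (snd d)"
      by (auto simp: hg)
  qed
  then have "satisfies (g ` W) f' e" using fol sem by (auto simp: follows_def)
  moreover have "range (g \<circ> \<phi>) \<subseteq> g ` W" using \<phi>W by auto
  ultimately have "word_value f' (g \<circ> \<phi>) (fst e) = word_value f' (g \<circ> \<phi>) (snd e)"
    unfolding satisfies_def by blast
  moreover have ne: "fst e \<noteq> []" "snd e \<noteq> []" using e by (auto simp: is_identity_def)
  ultimately have "g (word_value f \<phi> (fst e)) = g (word_value f \<phi> (snd e))"
    using word_value_hom[where h = g, OF semW \<phi>W _ ghom] by simp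
  moreover have "word_value f \<phi> (fst e) \<in> W" "word_value f \<phi> (snd e) \<in> W"
    using ne by (auto simp: W_def)
  ultimately show "word_value f \<phi> (fst e) = word_value f \<phi> (snd e)" by (metis hg)
qed


section \<open>The semigroups $A_2$ and $AC_2$\<close>

datatype a2 = Elt_a | Elt_b | Elt_ab | Elt_ba | Elt_0

fun a2_mult :: "a2 \<Rightarrow> a2 \<Rightarrow> a2" where
  "a2_mult Elt_a Elt_a = Elt_a"
| "a2_mult Elt_a Elt_b = Elt_ab"
| "a2_mult Elt_a Elt_ab = Elt_ab"
| "a2_mult Elt_a Elt_ba = Elt_a"
| "a2_mult Elt_b Elt_a = Elt_ba"
| "a2_mult Elt_b Elt_b = Elt_0"
| "a2_mult Elt_b Elt_ab = Elt_b"
| "a2_mult Elt_b Elt_ba = Elt_0"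
| "a2_mult Elt_ab Elt_a = Elt_a"
| "a2_mult Elt_ab Elt_b = Elt_0"
| "a2_mult Elt_ab Elt_ab = Elt_ab"
| "a2_mult Elt_ab Elt_ba = Elt_0"
| "a2_mult Elt_ba Elt_a = Elt_ba"
| "a2_mult Elt_ba Elt_b = Elt_b"
| "a2_mult Elt_ba Elt_ab = Elt_b"
| "a2_mult Elt_ba Elt_ba = Elt_ba"
| "a2_mult Elt_0 y = Elt_0"
| "a2_mult x Elt_0 = Elt_0"

text \<open>
  The next three lemmas state that the table is the one given by the presentation
  $\langle a,b \mid a^2=aba=a,\ bab=b,\ b^2=0\rangle$ in the class of semigroups with zero.
\<close>

lemma a2_semigroup: "semigroup_on UNIV a2_mult"
proof -
  have "a2_mult (a2_mult x y) z = a2_mult x (a2_mult y z)" for x y z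
    by (cases x; cases y; cases z) simp_all
  then show ?thesis by (simp add: semigroup_on_def)
qed

lemma a2_relations:
  "a2_mult Elt_a Elt_a = Elt_a"
  "a2_mult (a2_mult Elt_a Elt_b) Elt_a = Elt_a"
  "a2_mult (a2_mult Elt_b Elt_a) Elt_b = Elt_b"
  "a2_mult Elt_b Elt_b = Elt_0"
  "a2_mult Elt_a Elt_b = Elt_ab" "a2_mult Elt_b Elt_a = Elt_ba"
  "a2_mult Elt_0 x = Elt_0" "a2_mult x Elt_0 = Elt_0"
  by (cases x; simp)+

lemma a2_universal:
  assumes S: "semigroup_on S f" and "p \<in> S" "q \<in> S" "z \<in> S"
    and zero: "\<And>x. x \<in> S \<Longrightarrow> f z x = z" "\<And>x. x \<in> S \<Longrightarrow> f x z = z"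
    and rel: "f p p = p" "f (f p q) p = p" "f (f q p) q = q" "f q q = z"
  shows "\<exists>h. h Elt_a = p \<and> h Elt_b = q \<and> h Elt_0 = z \<and> range h \<subseteq> S \<and>
           (\<forall>x y. h (a2_mult x y) = f (h x) (h y))"
proof -
  define h where "h = case_a2 p q (f p q) (f q p) z"
  have cl: "f p q \<in> S" "f q p \<in> S" using assms by (auto simp: semigroup_on_def)
  have as: "f (f x y) w = f x (f y w)" if "x \<in> S" "y \<in> S" "w \<in> S" for x y w
    using S that by (auto simp: semigroup_on_def)
  have rel': "f p (f q p) = p" "f q (f p q) = q" "f p (f p q) = f p q" "f q (f q p) = z"
    using as[of p q p] as[of q p q] as[of p p q] as[of q q p] rel zero assms by auto
  have rel'': "f (f p q) q = z" "f (f q p) p = f q p" "f (f p q) (f p q) = f p q"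
    "f (f p q) (f q p) = z" "f (f q p) (f p q) = q" "f (f q p) (f q p) = f q p"
    using as[of p q q] as[of q p p] as[of p q "f p q"] as[of p q "f q p"]
      as[of q p "f p q"] as[of q p "f q p"] rel rel' cl zero assms by auto
  have "h (a2_mult x y) = f (h x) (h y)" for x y
    by (cases x; cases y) (simp_all add: h_def rel rel' rel'' zero cl assms)
  moreover have "h x \<in> S" for x
    using cl assms by (cases x) (simp_all add: h_def)
  ultimately show ?thesis by (intro exI[of _ h]) (auto simp: h_def)
qed

datatype ac2 = Of_A2 a2 | Elt_c

fun ac2_mult :: "ac2 \<Rightarrow> ac2 \<Rightarrow> ac2" where
  "ac2_mult (Of_A2 x) (Of_A2 y) = Of_A2 (a2_mult x y)"
| "ac2_mult (Of_A2 x) Elt_c = Elt_c"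
| "ac2_mult Elt_c (Of_A2 x) = Elt_c"
| "ac2_mult Elt_c Elt_c = Of_A2 Elt_0"

lemma ac2_semigroup: "semigroup_on UNIV ac2_mult"
proof -
  have "a2_mult (a2_mult x y) z = a2_mult x (a2_mult y z)" for x y z
    using a2_semigroup by (simp add: semigroup_on_def)
  then have "ac2_mult (ac2_mult x y) z = ac2_mult x (ac2_mult y z)" for x y z
    by (cases x; cases y; cases z) (simp_all add: a2_relations)
  then show ?thesis by (simp add: semigroup_on_def)
qed

lemma ac2_card: "card (UNIV :: ac2 set) = 6"
proof -
  have "(UNIV :: ac2 set) =
      {Of_A2 Elt_a, Of_A2 Elt_b, Of_A2 Elt_ab, Of_A2 Elt_ba, Of_A2 Elt_0, Elt_c}"
  proof (intro equalityI subsetI)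
    fix x :: ac2
    show "x \<in> {Of_A2 Elt_a, Of_A2 Elt_b, Of_A2 Elt_ab, Of_A2 Elt_ba, Of_A2 Elt_0, Elt_c}"
    proof (cases x)
      case (Of_A2 y)
      then show ?thesis by (cases y) simp_all
    qed simp
  qed simp
  from arg_cong[OF this, of card] show ?thesis by simp
qed


section \<open>Random access machines reading a multiplication table\<close>

text \<open>
  Deterministic random access machines with unit-cost instructions. The registers hold natural
  numbers and subtraction is truncated. The input semigroup has the elements \<open>0, \<dots>, n - 1\<close>;
  register \<open>0\<close> initially holds \<open>n\<close>, all the others hold \<open>0\<close>, and \<open>Product i j k\<close> looks up an entry
  of the multiplication table.
\<close>

datatype instr =
    Const nat nat           \<comment> \<open>\<open>X\<^sub>i := k\<close>\<close>
  | Add_Const nat nat nat   \<comment> \<open>\<open>X\<^sub>i := X\<^sub>j + k\<close>\<close>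
  | Add nat nat nat         \<comment> \<open>\<open>X\<^sub>i := X\<^sub>j + X\<^sub>k\<close>\<close>
  | Sub nat nat nat         \<comment> \<open>\<open>X\<^sub>i := X\<^sub>j - X\<^sub>k\<close>\<close>
  | Load nat nat            \<comment> \<open>\<open>X\<^sub>i := X\<close> at address \<open>X\<^sub>j\<close>\<close>
  | Store nat nat           \<comment> \<open>\<open>X\<close> at address \<open>X\<^sub>i\<close> \<open>:= X\<^sub>j\<close>\<close>
  | Product nat nat nat     \<comment> \<open>\<open>X\<^sub>i :=\<close> product of the elements \<open>X\<^sub>j\<close> and \<open>X\<^sub>k\<close>\<close>
  | Jump_Eq nat nat nat     \<comment> \<open>if \<open>X\<^sub>i = X\<^sub>j\<close> go to \<open>p\<close>\<close>
  | Jump_Less nat nat nat   \<comment> \<open>if \<open>X\<^sub>i < X\<^sub>j\<close> go to \<open>p\<close>\<close>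
  | Accept
  | Reject

type_synonym config = "nat \<times> (nat \<Rightarrow> nat)"

text \<open>A table lookup with an argument that is not an element of the semigroup returns \<open>0\<close>.\<close>

fun exec_instr :: "nat \<Rightarrow> (nat \<Rightarrow> nat \<Rightarrow> nat) \<Rightarrow> instr \<Rightarrow> config \<Rightarrow> config" where
  "exec_instr n m (Const i k) (pc, X) = (Suc pc, X(i := k))"
| "exec_instr n m (Add_Const i j k) (pc, X) = (Suc pc, X(i := X j + k))"
| "exec_instr n m (Add i j k) (pc, X) = (Suc pc, X(i := X j + X k))"
| "exec_instr n m (Sub i j k) (pc, X) = (Suc pc, X(i := X j - X k))"
| "exec_instr n m (Load i j) (pc, X) = (Suc pc, X(i := X (X j)))"
| "exec_instr n m (Store i j) (pc, X) = (Suc pc, X(X i := X j))"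
| "exec_instr n m (Product i j k) (pc, X) =
     (Suc pc, X(i := (if X j < n \<and> X k < n then m (X j) (X k) else 0)))"
| "exec_instr n m (Jump_Eq i j p) (pc, X) = (if X i = X j then p else Suc pc, X)"
| "exec_instr n m (Jump_Less i j p) (pc, X) = (if X i < X j then p else Suc pc, X)"
| "exec_instr n m Accept (pc, X) = (pc, X)"
| "exec_instr n m Reject (pc, X) = (pc, X)"

definition step :: "instr list \<Rightarrow> nat \<Rightarrow> (nat \<Rightarrow> nat \<Rightarrow> nat) \<Rightarrow> config \<Rightarrow> config" where
  "step P n m c = (if fst c < length P then exec_instr n m (P ! fst c) c else c)"

definition run :: "instr list \<Rightarrow> nat \<Rightarrow> (nat \<Rightarrow> nat \<Rightarrow> nat) \<Rightarrow> nat \<Rightarrow> config" where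
  "run P n m t = (step P n m ^^ t) (0, (\<lambda>_. 0)(0 := n))"

definition answers_within ::
    "instr list \<Rightarrow> nat \<Rightarrow> (nat \<Rightarrow> nat \<Rightarrow> nat) \<Rightarrow> nat \<Rightarrow> bool \<Rightarrow> bool" where
  "answers_within P n m T b \<longleftrightarrow>
     (\<exists>t\<le>T. fst (run P n m t) < length P \<and>
        P ! fst (run P n m t) = (if b then Accept else Reject))"

text \<open>
  Unit cost is a realistic measure only for short words, so all the register contents are required
  to be polynomially bounded in \<open>n\<close>, that is, to have \<open>O(log n)\<close> bits for \<open>n \<ge> 2\<close>.
\<close>

definition short_words :: "instr list \<Rightarrow> bool" where
  "short_words P \<longleftrightarrow>
     (\<exists>d. \<forall>n m t i. semigroup_on {..<n} m \<longrightarrow> snd (run P n m t) i \<le> d * n ^ d)"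

text \<open>
  \<open>decides_membership P B g T\<close>: on the multiplication table of every finite semigroup \<open>S\<close>, the
  program \<open>P\<close> decides in at most \<open>T |S|\<close> steps whether \<open>S\<close> lies in the variety generated by \<open>(B, g)\<close>.
\<close>

definition decides_membership ::
    "instr list \<Rightarrow> 'b set \<Rightarrow> ('b \<Rightarrow> 'b \<Rightarrow> 'b) \<Rightarrow> (nat \<Rightarrow> nat) \<Rightarrow> bool" where
  "decides_membership P B g T \<longleftrightarrow> short_words P \<and>
     (\<forall>n m. semigroup_on {..<n} m \<longrightarrow>
        answers_within P n m (T n) (in_variety {..<n} m B g))"

end

theory Submission
  imports Defs
begin

text \<open>
  A word is read as a walk on its letters, with an edge for every two adjacent letters. In $A_2$ the
  value of a word under nonzero substitutions is determined by its first letter, its last letter and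
  the set of its edges, and the elements $0, c$ form a group of order $2$, so that $AC_2$ moreover sees
  the parity of the number of occurrences of every letter. These data describe the identities of
  $AC_2$ completely (\<open>similar_satisfies_ac2\<close>, \<open>satisfies_ac2_similar\<close>). What they leave free is the
  parity with which an \<^emph>\<open>edge\<close> is used: if the edges \<open>x\<^sub>1y\<^sub>1, x\<^sub>1y\<^sub>2, x\<^sub>2y\<^sub>2, \<dots>, x\<^sub>ky\<^sub>k, x\<^sub>ky\<^sub>1\<close> form an alternating
  cycle, then all of their parities can be changed at once without changing that of a letter.

  No finite basis. Take the Rees matrix semigroup over the group of order $2$ whose sandwich matrix is
  supported on a single alternating cycle of length $2n$, with the nontrivial group element at exactly
  one place. A substitution for fewer than $n$ variables misses a row of the matrix, the cycle is
  broken, and the remaining matrix is a product of a row function and a column function; hence the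
  value of a word depends on the parities of its letters only, and all identities of $AC_2$ in
  fewer than $n$ variables hold (\<open>rees_cycle_satisfies\<close>). However, the identity
  $x_0^2 \cdots x_{n-1}^2 x_0 = (x_0^2 \cdots x_{n-1}^2)^2 x_0$ of $AC_2$ fails, as its two sides run
  through the cycle once and twice (\<open>rees_cycle_violates\<close>).

  Membership. Alternating cycles are the only obstruction, and products of squares detect them: a
  semigroup lies in the variety iff it satisfies $z^2 = z^4$, three more
  identities in at most three variables, and $w^2 = w^3$ for all products $w$ of squares
  (\<open>in_variety_ac2_iff\<close>). Indeed, the local identities make the loops at a letter of a walk commute, and
  they allow the insertion of a doubled loop wherever the walk passes its letter
  (\<open>insert_double_loop\<close>). So the loops at a base letter of a strongly connected walk behave like an
  abelian group of exponent $2$. Doubled loops through the base turn each letter \<open>x\<close> into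
  \<open>b\<^sub>x g\<^sub>x a\<^sub>x\<close>, where \<open>a\<^sub>x\<close> leads from the base to \<open>x\<close> and \<open>b\<^sub>x\<close> back, and each edge \<open>xy\<close> into the
  loop \<open>a\<^sub>x b\<^sub>y\<close>. By $w^2 = w^3$, the product of these loops around an alternating cycle is trivial
  (\<open>alternating_cycle\<close>), hence the loop of \<open>xy\<close> is a product of a potential of \<open>x\<close> and a potential of \<open>y\<close>
  (\<open>potentials_exist\<close>), and the value of the walk depends on the letter parities only
  (\<open>similar_covering_words\<close>). A general walk is cut at its strongly connected components.

  The criterion is checked by a single triple loop over \<open>x, y, z\<close>, which tests the local identities and
  meanwhile marks the products of squares: each value of \<open>x\<close> is one round of multiplying all marked
  elements by all squares, and $n$ rounds suffice since every round before saturation marks a new element.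
\<close>

section \<open>Words as walks\<close>

definition adj :: "'a list \<Rightarrow> ('a \<times> 'a) set" where
  "adj w = set (zip w (tl w))"

lemma adj_simps [simp]:
  "adj [] = {}" "adj [x] = {}" "adj (x # y # w) = insert (x, y) (adj (y # w))"
  by (auto simp: adj_def)

lemma adj_Cons: "w \<noteq> [] \<Longrightarrow> adj (x # w) = insert (x, hd w) (adj w)"
  by (cases w) auto

lemma adj_append:
  "u \<noteq> [] \<Longrightarrow> v \<noteq> [] \<Longrightarrow> adj (u @ v) = adj u \<union> adj v \<union> {(last u, hd v)}"
  by (induction u rule: list_nonempty_induct) (auto simp: adj_Cons)

lemma adj_append_subset: "adj u \<subseteq> adj (u @ v)" "adj v \<subseteq> adj (u @ v)"
  by (cases "u = []"; cases "v = []"; auto simp: adj_append)+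

lemma adj_set: "(x, y) \<in> adj w \<Longrightarrow> x \<in> set w \<and> y \<in> set w"
  by (induction w rule: induct_list012) auto

lemma adj_split:
  assumes "(x, y) \<in> adj w"
  shows "\<exists>u v. w = u @ x # y # v"
  using assms
proof (induction w rule: induct_list012)
  case (3 a b w)
  show ?case
  proof (cases "(x, y) = (a, b)")
    case True
    then show ?thesis by (intro exI[of _ "[]"] exI[of _ w]) (use True in simp)
  next
    case False
    then obtain u v where "b # w = u @ x # y # v" using 3 by auto
    then have "a # b # w = (a # u) @ x # y # v" by simp
    then show ?thesis by blast
  qed
qed auto

text \<open>
  Splitting a walk at a letter and counting that letter for both parts avoids the bridging edge, so
  that no case distinction on \<open>a\<close> remains.
\<close>

lemma adj_glue: "X \<noteq> [] \<Longrightarrow> adj (a @ X) = adj (a @ [hd X]) \<union> adj X"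
  by (cases "a = []") (auto simp: adj_append)

lemma set_eq_insert_Field: "w \<noteq> [] \<Longrightarrow> set w = insert (hd w) (Field (adj w))"
  by (induction w rule: induct_list012) auto

lemma set_eq_Field:
  assumes "adj w \<noteq> {}"
  shows "set w = Field (adj w)"
proof -
  obtain x y v where "w = x # y # v" using assms by (cases w rule: remdups_adj.cases) auto
  then show ?thesis using set_eq_insert_Field[of w] by auto
qed

lemma adj_subset_set: "adj w \<subseteq> set w \<times> set w"
  using adj_set by fast

section \<open>The identities of $AC_2$\<close>

text \<open>
  These are the data of a walk that $AC_2$ sees: \<open>similar p q\<close> will be equivalent to $AC_2$
  satisfying $p = q$.
\<close>

definition similar :: "'a list \<Rightarrow> 'a list \<Rightarrow> bool" where
  "similar p q \<longleftrightarrow> p \<noteq> [] \<and> q \<noteq> [] \<and> hd p = hd q \<and> last p = last q \<and>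
     set p = set q \<and> adj p = adj q \<and> (\<forall>x. even (count_list p x) = even (count_list q x))"

text \<open>
  Coordinates that exhibit $A_2$ as a Rees matrix semigroup over the trivial group: \<open>a2_elt i l\<close> has row
  \<open>i\<close> and column \<open>l\<close>, and the sandwich matrix has its only zero at \<open>(True, True)\<close>.
\<close>

definition a2_elt :: "bool \<Rightarrow> bool \<Rightarrow> a2" where
  "a2_elt i l = (if i then if l then Elt_b else Elt_ba else if l then Elt_ab else Elt_a)"

lemma a2_elt_simps [simp]:
  "a2_mult (a2_elt i l) (a2_elt j k) = (if l \<and> j then Elt_0 else a2_elt i k)"
  "a2_mult Elt_0 x = Elt_0" "a2_mult x Elt_0 = Elt_0"
  "a2_elt i l = a2_elt j k \<longleftrightarrow> i = j \<and> l = k"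
  "a2_elt i l \<noteq> Elt_0" "Elt_0 \<noteq> a2_elt i l"
  by (simp_all add: a2_elt_def a2_relations)

text \<open>
  Each edge \<open>xy\<close> excludes the single combination \<open>l x \<and> i y\<close>. So the nonzero substitutions determine the
  set of edges, and the value of a walk only shows its two ends.
\<close>

lemma a2_value:
  assumes "w \<noteq> []" "\<And>x. x \<in> set w \<Longrightarrow> \<phi> x = a2_elt (i x) (l x)"
  shows "word_value a2_mult \<phi> w =
    (if \<exists>(x, y) \<in> adj w. l x \<and> i y then Elt_0 else a2_elt (i (hd w)) (l (last w)))"
  using assms
proof (induction w rule: list_nonempty_induct)
  case (cons x w)
  then have "word_value a2_mult \<phi> (x # w) = a2_mult (a2_elt (i x) (l x)) (word_value a2_mult \<phi> w)"
    by (simp add: word_value_Cons)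
  then show ?case using cons by (auto simp: adj_Cons)
qed simp

lemma a2_value_zero:
  assumes "x \<in> set w" "\<phi> x = Elt_0"
  shows "word_value a2_mult \<phi> w = Elt_0"
  using assms
proof (induction w)
  case (Cons y w)
  then show ?case by (cases "w = []") (auto simp: word_value_Cons)
qed simp

lemma similar_a2:
  assumes "similar p q"
  shows "word_value a2_mult \<phi> p = word_value a2_mult \<phi> q"
proof (cases "\<exists>x\<in>set p. \<phi> x = Elt_0")
  case True
  then show ?thesis using a2_value_zero assms by (metis similar_def)
next
  case False
  define i where "i x = (\<phi> x \<in> {Elt_b, Elt_ba})" for x
  define l where "l x = (\<phi> x \<in> {Elt_b, Elt_ab})" for x
  have \<phi>: "\<phi> x = a2_elt (i x) (l x)" if "x \<in> set p" for x
    using False that by (cases "\<phi> x") (auto simp: i_def l_def a2_elt_def)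
  show ?thesis
    using assms \<phi> a2_value[of p \<phi> i l] a2_value[of q \<phi> i l] by (auto simp: similar_def)
qed

lemma ac2_value_A2:
  assumes "w \<noteq> []" "\<And>x. x \<in> set w \<Longrightarrow> \<phi> x = Of_A2 (\<psi> x)"
  shows "word_value ac2_mult \<phi> w = Of_A2 (word_value a2_mult \<psi> w)"
  using assms by (induction w rule: list_nonempty_induct) (simp_all add: word_value_Cons)

text \<open>
  An element of $A_2$ acts as the identity on the group \<open>{0, c}\<close>, so as soon as some letter goes to $c$
  only the number of such letters modulo $2$ matters.
\<close>

lemma ac2_value_c:
  assumes "w \<noteq> []" "\<exists>x\<in>set w. \<phi> x = Elt_c"
  shows "word_value ac2_mult \<phi> w = (if odd (length (filter (\<lambda>x. \<phi> x = Elt_c) w)) then Elt_c else Of_A2 Elt_0)"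
  using assms
proof (induction w rule: list_nonempty_induct)
  case (single x)
  then show ?case by simp
next
  case (cons x w)
  show ?case
  proof (cases "\<exists>x\<in>set w. \<phi> x = Elt_c")
    case True
    then show ?thesis using cons
      by (cases "\<phi> x") (auto simp: word_value_Cons a2_relations)
  next
    case False
    then have "\<forall>x\<in>set w. \<exists>a. \<phi> x = Of_A2 a" by (metis ac2.exhaust)
    then obtain \<psi> where "\<And>x. x \<in> set w \<Longrightarrow> \<phi> x = Of_A2 (\<psi> x)" by metis
    then have "word_value ac2_mult \<phi> w = Of_A2 (word_value a2_mult \<psi> w)"
      using cons.hyps ac2_value_A2 by blast
    moreover have "filter (\<lambda>x. \<phi> x = Elt_c) w = []" using False by (simp add: filter_empty_conv)
    ultimately show ?thesis using cons False by (auto simp: word_value_Cons )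
  qed
qed

lemma length_filter_eq_sum_count:
  assumes "finite A" "set w \<subseteq> A"
  shows "length (filter Q w) = (\<Sum>x\<in>{x\<in>A. Q x}. count_list w x)"
  using assms(2)
proof (induction w)
  case (Cons y w)
  have "(\<Sum>x\<in>{x\<in>A. Q x}. count_list (y # w) x) =
      (\<Sum>x\<in>{x\<in>A. Q x}. count_list w x + (if y = x then 1 else 0))"
    by (intro sum.cong) auto
  then show ?case using Cons assms(1) by (simp add: sum.distrib)
qed simp

text \<open>
  A parity condition on single letters carries over to sets of letters. This covers substitutions
  that send several letters to $c$.
\<close>

lemma similar_filter_parity:
  assumes "similar p q"
  shows "even (length (filter Q p)) = even (length (filter Q q))"
proof -
  have "finite (set p)" "set q \<subseteq> set p" using assms by (auto simp: similar_def)
  then show ?thesis using assms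
    by (simp add: length_filter_eq_sum_count[of "set p"] similar_def even_sum_iff)
qed

lemma similar_satisfies_ac2:
  assumes "similar p q"
  shows "satisfies (UNIV :: ac2 set) ac2_mult (p, q)"
  unfolding satisfies_def fst_conv snd_conv
proof (intro allI impI)
  fix \<phi> :: "nat \<Rightarrow> ac2"
  have ne: "p \<noteq> []" "q \<noteq> []" and set: "set p = set q" using assms by (auto simp: similar_def)
  show "word_value ac2_mult \<phi> p = word_value ac2_mult \<phi> q"
  proof (cases "\<exists>x\<in>set p. \<phi> x = Elt_c")
    case True
    then show ?thesis
      using ne set ac2_value_c[of p \<phi>] ac2_value_c[of q \<phi>] similar_filter_parity[OF assms]
      by simp
  next
    case False
    then have "\<forall>x\<in>set p. \<exists>a. \<phi> x = Of_A2 a" by (metis ac2.exhaust)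
    then obtain \<psi> where "\<And>x. x \<in> set p \<Longrightarrow> \<phi> x = Of_A2 (\<psi> x)" by metis
    then show ?thesis using ac2_value_A2[where \<phi> = \<phi> and \<psi> = \<psi>] ne set similar_a2[OF assms] by metis
  qed
qed

text \<open>
  Every item of \<open>similar\<close> is detected by one kind of substitution: the ends by a row or column coordinate
  that singles out one letter, an edge \<open>xy\<close> by making \<open>l x \<and> i y\<close> the only obstacle, and content
  and parities by sending a single letter to $c$.
\<close>

lemma satisfies_ac2_similar:
  assumes sat: "satisfies (UNIV :: ac2 set) ac2_mult (p, q)" and ne: "p \<noteq> []" "q \<noteq> []"
  shows "similar p q"
proof -
  have eq: "word_value ac2_mult \<phi> p = word_value ac2_mult \<phi> q" for \<phi>
    using sat by (simp add: satisfies_def)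
  have eq2: "word_value a2_mult \<psi> p = word_value a2_mult \<psi> q" for \<psi>
    using eq[of "Of_A2 \<circ> \<psi>"] ne ac2_value_A2[of _ "Of_A2 \<circ> \<psi>" \<psi>] by auto
  have hd: "hd p = hd q"
    using eq2[of "\<lambda>x. a2_elt (x = hd p) False"] ne
      a2_value[of _ "\<lambda>x. a2_elt (x = hd p) False" "\<lambda>x. x = hd p" "\<lambda>_. False"] by auto
  have last: "last p = last q"
    using eq2[of "\<lambda>x. a2_elt False (x = last p)"] ne
      a2_value[of _ "\<lambda>x. a2_elt False (x = last p)" "\<lambda>_. False" "\<lambda>x. x = last p"] by auto
  have "(x, y) \<in> adj p \<longleftrightarrow> (x, y) \<in> adj q" for x y
  proof -
    let ?i = "\<lambda>z. z = y" and ?l = "\<lambda>z. z = x"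
    have "word_value a2_mult (\<lambda>z. a2_elt (?i z) (?l z)) w = Elt_0 \<longleftrightarrow> (x, y) \<in> adj w"
      if "w \<noteq> []" for w
      using a2_value[OF that, of "\<lambda>z. a2_elt (?i z) (?l z)" ?i ?l] by auto
    then show ?thesis using eq2[of "\<lambda>z. a2_elt (?i z) (?l z)"] ne by metis
  qed
  then have adj: "adj p = adj q" by auto
  have letter: "(x \<in> set p \<longleftrightarrow> x \<in> set q) \<and> (odd (count_list p x) \<longleftrightarrow> odd (count_list q x))" for x
  proof -
    let ?\<phi> = "\<lambda>z. if z = x then Elt_c else Of_A2 Elt_a"
    have v: "word_value ac2_mult ?\<phi> w = (if x \<in> set w then if odd (count_list w x) then Elt_c
        else Of_A2 Elt_0 else Of_A2 Elt_a)" if "w \<noteq> []" for w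
    proof (cases "x \<in> set w")
      case True
      have "length (filter (\<lambda>x. ?\<phi> x = Elt_c) w) = count_list w x" by (induction w) auto
      moreover have "\<exists>z\<in>set w. ?\<phi> z = Elt_c" using True by auto
      ultimately show ?thesis using ac2_value_c[OF that, of ?\<phi>] True by simp
    next
      case False
      have "word_value a2_mult (\<lambda>_. Elt_a) w = Elt_a"
        using a2_value[OF that, of "\<lambda>_. Elt_a" "\<lambda>_. False" "\<lambda>_. False"] by (simp add: a2_elt_def)
      moreover have "?\<phi> z = Of_A2 Elt_a" if "z \<in> set w" for z using that False by auto
      ultimately show ?thesis using ac2_value_A2[OF that, of ?\<phi> "\<lambda>_. Elt_a"] False by simp
    qed
    show ?thesis using eq[of ?\<phi>] v[of p] v[of q] ne
      by (auto split: if_splits simp: count_list_0_iff)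
  qed
  then show ?thesis using hd last adj ne by (auto simp: similar_def)
qed

section \<open>No finite basis\<close>

text \<open>
  A Rees matrix semigroup with zero over the group of order $2$, written as \<open>bool\<close> with \<open>(\<noteq>)\<close> as its
  operation. The semigroup zero is \<open>None\<close>, and so is a zero entry of the sandwich matrix \<open>P\<close>.
\<close>

fun rees_mult :: "(nat \<Rightarrow> nat \<Rightarrow> bool option) \<Rightarrow>
    (nat \<times> bool \<times> nat) option \<Rightarrow> (nat \<times> bool \<times> nat) option \<Rightarrow> (nat \<times> bool \<times> nat) option" where
  "rees_mult P (Some (i, g, l)) (Some (j, h, k)) =
     (case P l j of None \<Rightarrow> None | Some c \<Rightarrow> Some (i, g \<noteq> (c \<noteq> h), k))"
| "rees_mult P None y = None"
| "rees_mult P x None = None"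

definition rees_carrier :: "nat \<Rightarrow> (nat \<times> bool \<times> nat) option set" where
  "rees_carrier n = insert None (Some ` ({..<n} \<times> UNIV \<times> {..<n}))"

lemma rees_zero [simp]: "rees_mult P x None = None"
  by (cases x) auto

lemma rees_semigroup: "semigroup_on (rees_carrier n) (rees_mult P)"
proof -
  have "rees_mult P (rees_mult P (Some (i, g, l)) (Some (i', g', l'))) (Some (i'', g'', l'')) =
      rees_mult P (Some (i, g, l)) (rees_mult P (Some (i', g', l')) (Some (i'', g'', l'')))"
    for i g l i' g' l' i'' g'' l''
    by (cases "P l i'"; cases "P l' i''") auto
  then have "rees_mult P (rees_mult P x y) z = rees_mult P x (rees_mult P y z)" for x y z
    by (cases x; cases y; cases z) (simp_all add: split_paired_all)
  moreover have "rees_mult P x y \<in> rees_carrier n"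
    if "x \<in> rees_carrier n" "y \<in> rees_carrier n" for x y
    using that by (cases "(P, x, y)" rule: rees_mult.cases)
      (auto simp: rees_carrier_def image_iff split: option.split)
  ultimately show ?thesis by (auto simp: semigroup_on_def rees_carrier_def)
qed

lemma rees_value_zero:
  assumes "x \<in> set w" "\<phi> x = None"
  shows "word_value (rees_mult P) \<phi> w = None"
  using assms
proof (induction w)
  case (Cons y w)
  then show ?case by (cases "w = []") (auto simp: word_value_Cons)
qed simp

lemma odd_filter_Cons:
  "odd (length (filter Q (x # w))) = (Q x \<noteq> odd (length (filter Q w)))"
  by simp

lemma xor_telescope:
  fixes g' c N N' a b a' b' :: bool
  assumes "c = (a \<noteq> b')" "N' = ((g' \<noteq> (b \<noteq> a)) \<noteq> N)"
  shows "(g' \<noteq> (c \<noteq> (N \<noteq> (b' \<noteq> a')))) = (N' \<noteq> (b \<noteq> a'))"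
  using assms by auto

text \<open>
  If on the edges of \<open>w\<close> the sandwich matrix splits into \<open>\<alpha>\<close> of the left letter and \<open>\<beta>\<close> of the right
  one, then both can be moved into the letters. The two ends apart, the group component then counts
  letters and not edges.
\<close>

lemma rees_value:
  fixes \<alpha> \<beta> :: "nat \<Rightarrow> bool"
  assumes "w \<noteq> []" "\<And>x. x \<in> set w \<Longrightarrow> \<phi> x = Some (i x, g x, l x)"
    and "\<And>x y c. (x, y) \<in> adj w \<Longrightarrow> P (l x) (i y) = Some c \<Longrightarrow> c = (\<alpha> (l x) \<noteq> \<beta> (i y))"
  shows "word_value (rees_mult P) \<phi> w =
    (if \<exists>(x, y) \<in> adj w. P (l x) (i y) = None then None
     else Some (i (hd w), odd (length (filter (\<lambda>x. g x \<noteq> (\<beta> (i x) \<noteq> \<alpha> (l x))) w)) \<noteq>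
       (\<beta> (i (hd w)) \<noteq> \<alpha> (l (last w))), l (last w)))"
  using assms
proof (induction w rule: list_nonempty_induct)
  case (cons x w)
  let ?N = "\<lambda>w. odd (length (filter (\<lambda>x. g x \<noteq> (\<beta> (i x) \<noteq> \<alpha> (l x))) w))"
  have step: "word_value (rees_mult P) \<phi> (x # w) =
      rees_mult P (Some (i x, g x, l x)) (word_value (rees_mult P) \<phi> w)"
    using cons.hyps cons.prems(1)[of x] by (simp add: word_value_Cons)
  have IH: "word_value (rees_mult P) \<phi> w =
      (if \<exists>(x, y) \<in> adj w. P (l x) (i y) = None then None
       else Some (i (hd w), ?N w \<noteq> (\<beta> (i (hd w)) \<noteq> \<alpha> (l (last w))), l (last w)))"
    using cons.prems cons.hyps by (intro cons.IH) (auto simp: adj_Cons)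
  show ?case
  proof (cases "P (l x) (i (hd w))")
    case None
    then show ?thesis using cons.hyps by (auto simp: step IH adj_Cons)
  next
    case (Some c)
    then have "c = (\<alpha> (l x) \<noteq> \<beta> (i (hd w)))"
      using cons.prems(2)[of x "hd w" c] cons.hyps by (simp add: adj_Cons)
    moreover have "?N (x # w) = ((g x \<noteq> (\<beta> (i x) \<noteq> \<alpha> (l x))) \<noteq> ?N w)"
      by (rule odd_filter_Cons)
    ultimately have total: "(g x \<noteq> (c \<noteq> (?N w \<noteq> (\<beta> (i (hd w)) \<noteq> \<alpha> (l (last w)))))) =
        (?N (x # w) \<noteq> (\<beta> (i x) \<noteq> \<alpha> (l (last w))))" by (rule xor_telescope)
    have zero: "(\<exists>(x, y) \<in> adj (x # w). P (l x) (i y) = None) =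
        (\<exists>(x, y) \<in> adj w. P (l x) (i y) = None)"
      using Some cons.hyps by (simp add: adj_Cons)
    have mult: "rees_mult P (Some (i x, g x, l x)) (Some (i (hd w), h, k)) =
        Some (i x, g x \<noteq> (c \<noteq> h), k)" for h k
      using Some by simp
    have "last (x # w) = last w" using cons.hyps by simp
    then show ?thesis unfolding step IH zero list.sel
      by (simp only: mult total rees_zero split: if_split) simp
  qed
qed auto

text \<open>
  Row \<open>l\<close> has nonzero entries in the columns \<open>l\<close> and \<open>l + 1\<close> modulo \<open>n\<close>, so the nonzero positions form one
  cycle of length \<open>2 n\<close>. The only nontrivial group element stands where the cycle closes.
\<close>

definition cycle_matrix :: "nat \<Rightarrow> nat \<Rightarrow> nat \<Rightarrow> bool option" where
  "cycle_matrix n l i = (if i = l then Some False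
     else if i = Suc l mod n then Some (Suc l = n) else None)"

text \<open>
  Without row \<open>k\<close> the cycle becomes a path, and a step function with its jump at \<open>k\<close> is a potential: it
  takes the values \<open>True\<close> at column \<open>0\<close> and \<open>False\<close> at the last column, which accounts for the
  nontrivial entry (for \<open>k = n - 1\<close> the nontrivial entry itself is removed).
\<close>

lemma cycle_matrix_gauge:
  assumes "l < n" "l \<noteq> k" "k < n" "2 \<le> n" "cycle_matrix n l i = Some c"
  shows "c = (((Suc l mod n \<le> k) \<noteq> (Suc l = n)) \<noteq> (i \<le> k))"
  using assms by (cases "Suc l = n") (auto simp: cycle_matrix_def split: if_splits)

lemma rees_cycle_satisfies:
  assumes sat: "satisfies (UNIV :: ac2 set) ac2_mult (p, q)" and ne: "p \<noteq> []" "q \<noteq> []"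
    and small: "card (set p) < n" and n: "2 \<le> n"
  shows "satisfies (rees_carrier n) (rees_mult (cycle_matrix n)) (p, q)"
  unfolding satisfies_def fst_conv snd_conv
proof (intro allI impI)
  fix \<phi> :: "nat \<Rightarrow> (nat \<times> bool \<times> nat) option" assume \<phi>: "range \<phi> \<subseteq> rees_carrier n"
  let ?v = "word_value (rees_mult (cycle_matrix n)) \<phi>"
  have sim: "similar p q" using satisfies_ac2_similar[OF sat ne] .
  then have set: "set q = set p" by (simp add: similar_def)
  show "?v p = ?v q"
  proof (cases "\<exists>x\<in>set p. \<phi> x = None")
    case True
    then show ?thesis using rees_value_zero set by metis
  next
    case False
    define i where "i x = fst (the (\<phi> x))" for x
    define g where "g x = fst (snd (the (\<phi> x)))" for x
    define l where "l x = snd (snd (the (\<phi> x)))" for x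
    have \<phi>': "\<phi> x = Some (i x, g x, l x)" if "x \<in> set p" for x
      using False that by (auto simp: i_def g_def l_def)
    have ln: "l x < n" if "x \<in> set p" for x
    proof -
      have "\<phi> x \<in> rees_carrier n" using \<phi> by auto
      then show ?thesis using \<phi>'[OF that] by (auto simp: rees_carrier_def)
    qed
    \<comment> \<open>The word \<open>p\<close> has fewer than \<open>n\<close> letters, so some row \<open>k\<close> is used by none of them.\<close>
    have "card (l ` set p) < n" using small card_image_le[of "set p" l] by simp
    moreover have "l ` set p \<subseteq> {..<n}" using ln by auto
    ultimately obtain k where k: "k < n" "k \<notin> l ` set p"
      by (metis card_lessThan lessThan_iff order_less_irrefl subsetI subset_antisym)
    define \<alpha> where "\<alpha> a = ((Suc a mod n \<le> k) \<noteq> (Suc a = n))" for a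
    define \<beta> where "\<beta> a = (a \<le> k)" for a
    have gauge: "c = (\<alpha> (l x) \<noteq> \<beta> (i y))"
      if "x \<in> set p" "cycle_matrix n (l x) (i y) = Some c" for x y c
      unfolding \<alpha>_def \<beta>_def using cycle_matrix_gauge[OF ln[OF that(1)] _ k(1) n that(2)] k that by auto
    have val: "?v w = (if \<exists>(x, y) \<in> adj w. cycle_matrix n (l x) (i y) = None then None
     else Some (i (hd w), odd (length (filter (\<lambda>x. g x \<noteq> (\<beta> (i x) \<noteq> \<alpha> (l x))) w)) \<noteq>
       (\<beta> (i (hd w)) \<noteq> \<alpha> (l (last w))), l (last w)))" if "w \<noteq> []" "set w = set p" for w
    proof (rule rees_value[OF that(1)])
      fix x y c assume "(x, y) \<in> adj w" "cycle_matrix n (l x) (i y) = Some c"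
      then show "c = (\<alpha> (l x) \<noteq> \<beta> (i y))" using gauge[of x y c] adj_set[of x y w] that by simp
    qed (use that \<phi>' in simp)
    have "hd q = hd p" "last q = last p" "adj q = adj p" using sim by (simp_all add: similar_def)
    then show ?thesis
      unfolding val[OF ne(1) refl] val[OF ne(2) set] by (simp only: similar_filter_parity[OF sim])
  qed
qed

definition squares_word :: "nat \<Rightarrow> nat list" where
  "squares_word n = concat (map (\<lambda>i. [i, i]) [0..<n])"

lemma squares_word_Suc: "squares_word (Suc n) = squares_word n @ [n, n]"
  by (simp add: squares_word_def)

lemma squares_word_props:
  assumes "0 < n"
  shows "squares_word n \<noteq> []" "hd (squares_word n) = 0"
    "even (count_list (squares_word n) x)"
proof -
  show "even (count_list (squares_word n) x)"
    by (induction n) (simp_all add: squares_word_Suc squares_word_def[of 0])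
  have "squares_word n \<noteq> [] \<and> hd (squares_word n) = 0" using assms
  proof (induction n rule: nat_induct_non_zero)
    case 1
    then show ?case by (simp add: squares_word_def)
  next
    case (Suc n)
    then show ?case by (simp add: squares_word_Suc)
  qed
  then show "squares_word n \<noteq> []" "hd (squares_word n) = 0" by auto
qed

text \<open>
  On both sides letter \<open>0\<close> is odd and the other letters are even; the second passage adds no edge, since
  the first one already contains the edge from the last square back to \<open>0\<close>.
\<close>

lemma squares_identity:
  assumes "0 < n"
  shows "similar (squares_word n @ [0]) (squares_word n @ squares_word n @ [0])"
  using squares_word_props[OF assms] by (auto simp: similar_def adj_append)

text \<open>
  With \<open>i\<close> sent to the element with row \<open>i\<close> and column \<open>i\<close>, the walk runs along the cycle of the matrix: the
  squares use the entries \<open>(i, i)\<close>, and the step from \<open>i\<close> to \<open>i + 1\<close> uses the other entry of row \<open>i\<close>.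
\<close>

lemma squares_word_value:
  assumes "0 < k" "k \<le> n" "\<And>i. i < n \<Longrightarrow> \<phi> i = Some (i, False, i)" "range \<phi> \<subseteq> rees_carrier n"
  shows "word_value (rees_mult (cycle_matrix n)) \<phi> (squares_word k) = Some (0, False, k - 1)"
  using assms(1,2)
proof (induction k rule: nat_induct_non_zero)
  case 1
  then show ?case using assms(3) by (simp add: squares_word_def cycle_matrix_def)
next
  case (Suc k)
  have "rees_mult (cycle_matrix n) (Some (k, False, k)) (Some (k, False, k)) = Some (k, False, k)"
    by (simp add: cycle_matrix_def)
  then have "word_value (rees_mult (cycle_matrix n)) \<phi> (squares_word k @ [k, k]) =
     rees_mult (cycle_matrix n) (Some (0, False, k - 1)) (Some (k, False, k))"
    using Suc assms(3) squares_word_props(1)[of k]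
    by (simp add: word_value_append[OF rees_semigroup assms(4)])
  also have "\<dots> = Some (0, False, k)" using Suc by (simp add: cycle_matrix_def)
  finally show ?case by (simp add: squares_word_Suc)
qed

text \<open>
  Each side passes the nontrivial entry as often as it returns from the last square to \<open>0\<close>, that is,
  once on the left and twice on the right.
\<close>

lemma rees_cycle_violates:
  assumes n: "2 \<le> n"
  shows "\<not> satisfies (rees_carrier n) (rees_mult (cycle_matrix n))
    (squares_word n @ [0], squares_word n @ squares_word n @ [0])"
proof -
  define \<phi> where "\<phi> i = (if i < n then Some (i, False, i) else None)" for i
  have \<phi>: "range \<phi> \<subseteq> rees_carrier n" by (auto simp: \<phi>_def rees_carrier_def)
  let ?v = "word_value (rees_mult (cycle_matrix n)) \<phi>"
  have W: "?v (squares_word n) = Some (0, False, n - 1)" "squares_word n \<noteq> []"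
    using squares_word_value[of n n \<phi>] \<phi> n squares_word_props(1)[of n] by (auto simp: \<phi>_def)
  have zero: "\<phi> 0 = Some (0, False, 0)" using n by (simp add: \<phi>_def)
  have u: "?v (squares_word n @ [0]) = Some (0, True, 0)"
    using W n zero by (simp add: word_value_append[OF rees_semigroup \<phi>] cycle_matrix_def)
  then have "?v (squares_word n @ squares_word n @ [0]) = Some (0, False, 0)"
    using W n by (simp add: word_value_append[OF rees_semigroup \<phi>, of "squares_word n" "_ @ _"]
      cycle_matrix_def)
  then show ?thesis using u \<phi> unfolding satisfies_def by (auto intro!: exI[of _ \<phi>])
qed

theorem ac2_not_finitely_based: "\<not> finitely_based (UNIV :: ac2 set) ac2_mult"
proof
  assume "finitely_based (UNIV :: ac2 set) ac2_mult"
  then obtain \<Sigma> where fin: "finite \<Sigma>" and basis: "identity_basis \<Sigma> (UNIV :: ac2 set) ac2_mult"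
    by (auto simp: finitely_based_def)
  define A where "A = (\<Union>d\<in>\<Sigma>. set (fst d))"
  \<comment> \<open>The summand 2 makes \<open>n\<close> exceed the number of variables and keeps the two entries of a row distinct.\<close>
  define n where "n = card A + 2"
  let ?e = "(squares_word n @ [0], squares_word n @ squares_word n @ [0])"
  have "is_identity ?e" by (simp add: is_identity_def)
  moreover have "satisfies (UNIV :: ac2 set) ac2_mult ?e"
    using similar_satisfies_ac2[OF squares_identity] by (simp add: n_def)
  ultimately have fol: "follows \<Sigma> ?e" using basis by (simp add: identity_basis_def)
  have \<Sigma>: "\<forall>d\<in>\<Sigma>. is_identity d" using basis by (simp add: identity_basis_def)
  have "satisfies (rees_carrier n) (rees_mult (cycle_matrix n)) d" if d: "d \<in> \<Sigma>" for d
  proof -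
    have "card (set (fst d)) \<le> card A" using fin d by (intro card_mono) (auto simp: A_def)
    then show ?thesis
      using rees_cycle_satisfies[of "fst d" "snd d" n] d basis
      by (auto simp: identity_basis_def is_identity_def n_def)
  qed
  then have "satisfies (rees_carrier n) (rees_mult (cycle_matrix n)) ?e"
    using follows_satisfies[OF fol \<open>is_identity ?e\<close> \<Sigma> rees_semigroup] by blast
  then show False using rees_cycle_violates[of n] by (simp add: n_def)
qed

section \<open>Loops of a walk\<close>

text \<open>
  A loop at \<open>s\<close> omits its final \<open>s\<close>, so that loops can be concatenated; it has to be followed by a word that
  starts with \<open>s\<close>. The empty word is included as the neutral element.
\<close>

definition loop :: "('a \<times> 'a) set \<Rightarrow> 'a \<Rightarrow> 'a list \<Rightarrow> bool" where
  "loop E s w \<longleftrightarrow> w = [] \<or> hd w = s \<and> adj (w @ [s]) \<subseteq> E"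

lemma loop_Nil [simp]: "loop E s []"
  by (simp add: loop_def)

lemma loop_append: "loop E s v \<Longrightarrow> loop E s w \<Longrightarrow> loop E s (v @ w)"
  using adj_glue[of "w @ [s]" v] by (cases "v = []"; cases "w = []") (auto simp: loop_def)

lemma loop_concat: "(\<And>l. l \<in> set ls \<Longrightarrow> loop E s l) \<Longrightarrow> loop E s (concat ls)"
  by (induction ls) (auto intro: loop_append)

lemma adj_insert_loop:
  assumes "loop E x c" "adj (u @ x # v) = E"
  shows "adj (u @ c @ x # v) = E"
proof (cases "c = []")
  case False
  have "adj (u @ c @ x # v) = adj (u @ [x]) \<union> adj (c @ x # v)"
    using adj_glue[of "c @ x # v" u] False assms(1) by (simp add: loop_def)
  also have "\<dots> = adj (u @ [x]) \<union> adj (c @ [x]) \<union> adj (x # v)"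
    using adj_glue[of "x # v" c] by auto
  also have "\<dots> = E" using assms adj_glue[of "x # v" u] False by (auto simp: loop_def)
  finally show ?thesis .
qed (use assms in simp)

text \<open>
  The abstract setting: \<open>V\<close> identifies words compatibly with concatenation. The laws \<open>cube\<close> and \<open>commute\<close>
  are the ones for loops at a letter, and \<open>core\<close> is $w^2 = w^3$ for products of squares.
\<close>

locale loop_congruence =
  fixes V :: "'a list \<Rightarrow> 'b"
  assumes ctx: "V u = V v \<Longrightarrow> V (a @ u @ b) = V (a @ v @ b)"
    and cube: "V (x # A @ x # A @ x # A @ [x]) = V (x # A @ [x])"
    and commute: "V (x # A @ x # B @ [x]) = V (x # B @ x # A @ [x])"
    and core: "[] \<notin> set us \<Longrightarrow> F = concat (map (\<lambda>u. u @ u) us) \<Longrightarrow> V (F @ F @ F) = V (F @ F)"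
begin

lemma cube_ctx:
  assumes "w = [] \<or> hd w = x" "X \<noteq> []" "hd X = x"
  shows "V (u @ w @ w @ w @ X) = V (u @ w @ X)"
proof (cases w)
  case (Cons y A)
  obtain X' where "X = x # X'" using assms by (cases X) auto
  then show ?thesis using ctx[OF cube[of x A], of u X'] Cons assms by simp
qed simp

lemma commute_ctx:
  assumes "v = [] \<or> hd v = x" "w = [] \<or> hd w = x" "X \<noteq> []" "hd X = x"
  shows "V (u @ v @ w @ X) = V (u @ w @ v @ X)"
proof (cases "v = [] \<or> w = []")
  case False
  obtain X' where "X = x # X'" using assms by (cases X) auto
  moreover obtain A where "v = x # A" using assms False by (cases v) auto
  moreover obtain B where "w = x # B" using assms False by (cases w) auto
  ultimately show ?thesis using ctx[OF commute[of x A B], of u X'] by simp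
qed auto

lemma prefix_ctx: "V u = V v \<Longrightarrow> V (a @ u) = V (a @ v)"
  using ctx[of u v a "[]"] by simp

end

text \<open>
  The loop \<open>K\<close> at \<open>s\<close> uses exactly the edges in \<open>E\<close>, hence \<open>E\<close> is strongly connected, and pieces of \<open>K\<close> serve as
  paths from \<open>s\<close> to any letter and back.
\<close>

locale covering_loop = loop_congruence V for V :: "'a list \<Rightarrow> 'b" +
  fixes E :: "('a \<times> 'a) set" and s :: 'a and K :: "'a list"
  assumes K_nonempty: "K \<noteq> []" and hd_K: "hd K = s" and adj_K: "adj (K @ [s]) = E"
begin

lemma loop_K: "loop E s K"
  using hd_K adj_K by (simp add: loop_def)

lemma loop_commute:
  assumes "loop E s v" "loop E s w" "X \<noteq> []" "hd X = s"
  shows "V (u @ v @ w @ X) = V (u @ w @ v @ X)"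
  using assms by (intro commute_ctx[where x = s]) (auto simp: loop_def)

text \<open>
  Next to two copies of \<open>K\<close> a doubled loop in \<open>E\<close> turns out to vanish (\<open>absorb\<close>). Until this is
  proved, the loops with that property are collected in a predicate, which is closed under
  concatenation and only depends on the class of the loop.
\<close>

definition absorbed :: "'a list \<Rightarrow> bool" where
  "absorbed v \<longleftrightarrow> loop E s v \<and> V (v @ v @ K @ K @ [s]) = V (K @ K @ [s])"

lemma KKs: "K @ X \<noteq> []" "hd (K @ X) = s"
  using K_nonempty hd_K by auto

lemma absorbed_append:
  assumes a: "absorbed a" and b: "absorbed b"
  shows "absorbed (a @ b)"
proof -
  have l: "loop E s a" "loop E s b" using assms by (auto simp: absorbed_def)
  have "V (a @ b @ a @ b @ K @ K @ [s]) = V (a @ a @ b @ b @ K @ K @ [s])"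
    using commute_ctx[of b s a "b @ K @ K @ [s]" a] l KKs[of "K @ [s]"] by (auto simp: loop_def hd_append)
  also have "\<dots> = V (a @ a @ K @ K @ [s])"
    using prefix_ctx[of "b @ b @ K @ K @ [s]" "K @ K @ [s]" "a @ a"] b by (simp add: absorbed_def)
  also have "\<dots> = V (K @ K @ [s])" using a by (simp add: absorbed_def)
  finally show ?thesis using l loop_append by (simp add: absorbed_def)
qed

lemma absorbed_K: "absorbed K"
  using cube_ctx[of K s "[s]" K] loop_K hd_K by (simp add: absorbed_def)

lemma absorbed_cong:
  assumes a: "absorbed a" and eq: "V (a @ [s]) = V (b @ [s])" and b: "loop E s b"
  shows "absorbed b"
proof -
  obtain Y where Y: "K @ K @ [s] = s # Y" using K_nonempty hd_K by (cases K) auto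
  have "V (b @ b @ K @ K @ [s]) = V (b @ a @ K @ K @ [s])"
    using ctx[OF eq, of b Y] by (simp add: Y)
  also have "\<dots> = V (a @ b @ K @ K @ [s])"
    using loop_commute[of b a "K @ K @ [s]" "[]"] a b KKs[of "K @ [s]"] by (simp add: absorbed_def)
  also have "\<dots> = V (a @ a @ K @ K @ [s])"
    using ctx[OF eq, of a Y] by (simp add: Y)
  finally show ?thesis using a b by (simp add: absorbed_def)
qed

text \<open>
  Induction on the walk: the absorbed loop found so far continues behind the letter \<open>x\<close> in some way, but
  \<open>K\<close> leaves \<open>x\<close> along the desired edge somewhere. Both are loops at \<open>x\<close> after multiplication with
  \<open>K\<close>, so commuting them brings the desired edge to the front.
\<close>

lemma walk_extends_to_absorbed:
  assumes "u \<noteq> []" "hd u = s" "adj u \<subseteq> E"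
  shows "\<exists>R. absorbed (u @ R)"
  using assms
proof (induction u rule: rev_nonempty_induct)
  case (single x)
  have "absorbed ([x] @ tl K)" using absorbed_K K_nonempty hd_K single by (cases K) auto
  then show ?case by blast
next
  case (snoc y u)
  have "adj (u @ [y]) = adj u \<union> {(last u, y)}" using snoc.hyps adj_append[of u "[y]"] by simp
  then have u: "adj u \<subseteq> E" "(last u, y) \<in> adj (K @ [s])" "hd u = s"
    using snoc adj_K by auto
  obtain R where R: "absorbed (u @ R)" using snoc u by auto
  define x where "x = last u"
  define u' where "u' = butlast u"
  have u': "u = u' @ [x]" using snoc.hyps by (simp add: x_def u'_def)
  obtain U W where UW: "K @ [s] = U @ x # y # W" using adj_split[OF u(2)] by (auto simp: x_def)
  define N where "N = butlast (y # W)"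
  have "last (y # W) = s" using arg_cong[OF UW, of last] by (simp split: if_splits)
  then have N: "N @ [s] = y # W" by (metis N_def append_butlast_last_id list.distinct(1))
  have K: "K = U @ x # N" using UW N by (metis append.assoc append_Cons append_same_eq)
  define A where "A = x # R @ U"
  define B where "B = x # N @ u'"
  define Z where "Z = u' @ B @ A @ A @ x # N"
  \<comment> \<open>The loop \<open>A\<close> at \<open>x\<close> follows the old continuation, the loop \<open>B\<close> at \<open>x\<close> starts with the edge from \<open>x\<close> to \<open>y\<close>.\<close>
  have word: "((u @ R) @ K @ (u @ R) @ K) @ [s] = u' @ A @ B @ A @ x # N @ [s]"
    by (simp add: u' K A_def B_def)
  have loop: "absorbed ((u @ R) @ K @ (u @ R) @ K)"
    using absorbed_append[OF absorbed_append[OF R absorbed_K] absorbed_append[OF R absorbed_K]] by simp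
  have eq: "V (((u @ R) @ K @ (u @ R) @ K) @ [s]) = V (Z @ [s])"
    unfolding word using commute_ctx[of A x B "A @ x # N @ [s]" u']
    by (simp add: Z_def) (simp add: A_def B_def)
  have adj_Z: "adj (Z @ [s]) = adj (((u @ R) @ K @ (u @ R) @ K) @ [s])"
    unfolding word Z_def using adj_glue[of "A @ B @ A @ x # N @ [s]" u'] adj_glue[of "B @ A @ A @ x # N @ [s]" u']
      adj_glue[of "B @ A @ x # N @ [s]" A] adj_glue[of "A @ x # N @ [s]" B] adj_glue[of "A @ A @ x # N @ [s]" B]
      adj_glue[of "A @ x # N @ [s]" A]
    by (auto simp: A_def B_def)
  \<comment> \<open>If \<open>N\<close> is empty then \<open>K\<close> ends with \<open>x\<close>, and the edge in question is the one from \<open>x\<close> to \<open>s\<close>.\<close>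
  have hd_Z: "hd (N @ u' @ A) = y"
  proof (cases "N = []")
    case True
    then have "y = s" using N by simp
    then show ?thesis using True u u' by (cases u') (auto simp: A_def)
  next
    case False
    then show ?thesis using N by (cases N) auto
  qed
  have "hd Z = s" using u(3) u' by (cases u') (auto simp: Z_def B_def)
  then have "loop E s Z" using loop unfolding loop_def absorbed_def adj_Z by auto
  then have "absorbed Z" using absorbed_cong[OF loop eq] by simp
  moreover have "Z = (u @ [y]) @ tl (N @ u' @ A) @ A @ x # N"
  proof -
    have "N @ u' @ A = y # tl (N @ u' @ A)" using hd_Z by (cases "N @ u' @ A") (auto simp: A_def)
    then have "Z = u' @ x # (y # tl (N @ u' @ A)) @ A @ x # N" by (simp add: Z_def B_def)
    then show ?thesis by (simp add: u')
  qed
  ultimately show ?case by (metis append_assoc)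
qed

text \<open>
  Extend \<open>w\<close> to an absorbed loop \<open>w w'\<close>. Its double is equivalent to the product of the doubles of \<open>w\<close> and
  \<open>w'\<close>, and a double is idempotent.
\<close>

lemma absorb:
  assumes "loop E s w"
  shows "V (w @ w @ K @ K @ [s]) = V (K @ K @ [s])"
proof (cases "w = []")
  case False
  then obtain R where R: "absorbed ((w @ [s]) @ R)"
    using walk_extends_to_absorbed[of "w @ [s]"] assms by (auto simp: loop_def)
  define w' where "w' = s # R"
  have ww': "absorbed (w @ w')" using R by (simp add: w'_def)
  then have "adj (w @ w' @ [s]) \<subseteq> E" by (simp add: absorbed_def loop_def w'_def)
  then have w': "loop E s w'" using adj_append_subset(2)[of "w' @ [s]" w] by (auto simp: loop_def w'_def)
  have eq: "V (w @ w @ w' @ w' @ K @ K @ [s]) = V (K @ K @ [s])"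
  proof -
    have "V (w @ w @ w' @ w' @ K @ K @ [s]) = V (w @ w' @ w @ w' @ K @ K @ [s])"
      using loop_commute[of w w' "w' @ K @ K @ [s]" w] assms w' by (simp add: w'_def)
    then show ?thesis using ww' by (simp add: absorbed_def)
  qed
  have "V (w @ w @ K @ K @ [s]) = V (w @ w @ w @ w @ w' @ w' @ K @ K @ [s])"
    using prefix_ctx[OF eq, of "w @ w"] by simp
  also have "\<dots> = V (w @ w @ w' @ w' @ K @ K @ [s])"
    using cube_ctx[of w s "w' @ w' @ K @ K @ [s]" w] assms by (auto simp: w'_def loop_def)
  finally show ?thesis using eq by simp
qed simp

lemma letter_splits_K:
  assumes "x \<in> Field E"
  shows "\<exists>U N. K = U @ x # N"
proof -
  have "Field E \<subseteq> set (K @ [s])" using adj_K set_eq_insert_Field[of "K @ [s]"] by auto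
  then have "x \<in> set K" using assms K_nonempty hd_K by (auto simp: hd_in_set)
  then show ?thesis by (auto simp: in_set_conv_decomp)
qed

lemma walk_from_base:
  assumes "x \<in> Field E"
  shows "\<exists>a. a \<noteq> [] \<and> hd a = s \<and> last a = x \<and> adj a \<subseteq> E"
proof -
  obtain U N where K: "K = U @ x # N" using letter_splits_K[OF assms] by blast
  then have "adj (U @ [x]) \<subseteq> E" using adj_K adj_append_subset(1)[of "U @ [x]" "N @ [s]"] by auto
  moreover have "hd (U @ [x]) = s" using hd_K K by (cases U) auto
  ultimately show ?thesis by (intro exI[of _ "U @ [x]"]) auto
qed

lemma walk_to_base:
  assumes "x \<in> Field E"
  shows "\<exists>b. b \<noteq> [] \<and> hd b = x \<and> adj (b @ [s]) \<subseteq> E"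
proof -
  obtain U N where "K = U @ x # N" using letter_splits_K[OF assms] by blast
  then have "adj ((x # N) @ [s]) \<subseteq> E" using adj_K adj_append_subset(2)[of "x # N @ [s]" U] by auto
  then show ?thesis by (intro exI[of _ "x # N"]) auto
qed

text \<open>
  The last letter of the extended word is left along any given edge somewhere in \<open>p\<close>; from there to the
  end the word runs through a loop, which \<open>cube\<close> allows to repeat. In this way a word that uses all of
  \<open>E\<close> can be prolonged along every walk in \<open>E\<close>, at the price of an uncontrolled tail \<open>Z\<close>.
\<close>

lemma word_extends_along_walk:
  assumes p: "p \<noteq> []" "adj p = E"
    and u: "u \<noteq> []" "hd u = last p" "adj u \<subseteq> E"
  shows "\<exists>Z. V p = V (p @ tl u @ Z)"
  using u
proof (induction u rule: rev_nonempty_induct)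
  case (single x)
  then show ?case by (intro exI[of _ "[]"]) simp
next
  case (snoc y u)
  define x where "x = last u"
  have "adj (u @ [y]) = adj u \<union> {(x, y)}" using snoc.hyps adj_append[of u "[y]"] by (simp add: x_def)
  then have u: "adj u \<subseteq> E" "(x, y) \<in> adj p" "hd u = last p" using snoc p by auto
  then obtain Z where Z: "V p = V (p @ tl u @ Z)" using snoc by auto
  obtain U W where UW: "p = U @ x # y # W" using adj_split[OF u(2)] by blast
  have "last (p @ tl u) = x" using u(3) snoc.hyps by (cases u) (auto simp: x_def)
  then have "last (y # W @ tl u) = x" by (simp add: UW)
  then obtain Q where Q: "y # W @ tl u = Q @ [x]"
    by (metis append_butlast_last_id list.distinct(1))
  have "p @ tl u = U @ x # (y # W @ tl u)" by (simp add: UW)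
  then have "(p @ tl u) @ Z = U @ (x # Q @ [x]) @ Z" unfolding Q by simp
  then have "p @ tl u @ Z = U @ (x # Q @ [x]) @ Z" by (simp only: append_assoc)
  then have "V p = V (U @ (x # Q @ [x]) @ Z)" using Z by argo
  also have "\<dots> = V (U @ (x # Q @ x # Q @ x # Q @ [x]) @ Z)" by (rule ctx) (simp add: cube)
  also have "U @ (x # Q @ x # Q @ x # Q @ [x]) @ Z = U @ x # (Q @ [x]) @ (Q @ [x]) @ Q @ [x] @ Z" by simp
  also have "\<dots> = p @ tl (u @ [y]) @ W @ tl u @ Q @ [x] @ Z"
    using snoc.hyps by (simp add: Q[symmetric] UW)
  finally show ?case by blast
qed

text \<open>
  Prolong \<open>p\<close> to a loop at \<open>s\<close> followed by two copies of \<open>K\<close>; the doubled loop commutes with the former and is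
  absorbed by the latter.
\<close>

lemma front_absorb:
  assumes p: "p \<noteq> []" "adj p = E" "hd p = s" and w: "loop E s w"
  shows "V (w @ w @ p) = V p"
proof -
  have "E \<noteq> {}" using adj_K K_nonempty by (auto simp: adj_append)
  then have "last p \<in> Field E" using p set_eq_Field[of p] by auto
  then obtain b where b: "b \<noteq> []" "hd b = last p" "adj (b @ [s]) \<subseteq> E" using walk_to_base by blast
  define P where "P = p @ tl b"
  have P: "P = butlast p @ b" using b p by (cases b) (auto simp: P_def)
  have "adj (P @ [s]) = adj p \<union> adj (b @ [s])"
    using adj_glue[of "b @ [s]" "butlast p"] b p by (simp add: P)
  moreover have "hd P = s" using p by (simp add: P_def)
  ultimately have lP: "loop E s P" using p b by (simp add: loop_def)
  have "adj (b @ K @ K @ [s]) \<subseteq> E"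
    using adj_glue[of "K @ K @ [s]" b] adj_glue[of "K @ [s]" K] b(3) adj_K KKs by auto
  then obtain Z where "V p = V (p @ tl (b @ K @ K @ [s]) @ Z)"
    using word_extends_along_walk[of p "b @ K @ K @ [s]"] p b by auto
  then have Vp: "V p = V (P @ K @ K @ [s] @ Z)" using b by (simp add: P_def)
  have "V (w @ w @ p) = V ((w @ w) @ P @ K @ K @ [s] @ Z)" using prefix_ctx[OF Vp, of "w @ w"] by simp
  also have "\<dots> = V (P @ (w @ w) @ K @ K @ [s] @ Z)"
    using loop_commute[OF loop_append[OF w w] lP KKs[of "K @ [s] @ Z"], of "[]"] by simp
  also have "\<dots> = V (P @ (K @ K @ [s]) @ Z)" using ctx[OF absorb[OF w], of P Z] by simp
  finally show ?thesis using Vp by simp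
qed

text \<open>
  A doubled loop at \<open>s\<close> in front that passes through \<open>x\<close> and \<open>K\<close> provides two copies of a loop \<open>D\<close> at \<open>x\<close> that
  covers \<open>E\<close>. Next to these, \<open>c\<close> is absorbed, with \<open>x\<close> as the base letter.
\<close>

lemma insert_double_loop:
  assumes p: "adj (u @ x # v) = E" "hd (u @ [x]) = s" and c: "loop E x c"
  shows "V (u @ c @ c @ x # v) = V (u @ x # v)"
proof -
  have E: "E \<noteq> {}" using adj_K K_nonempty by (auto simp: adj_append)
  then have "x \<in> Field E" using p set_eq_Field[of "u @ x # v"] by auto
  then obtain b where b: "b \<noteq> []" "hd b = x" "adj (b @ [s]) \<subseteq> E" using walk_to_base by blast
  have hd: "hd (u @ x # v) = s" using p(2) by (cases u) auto
  have ux: "adj (u @ [x]) \<subseteq> E" using p adj_append_subset(1)[of "u @ [x]" v] by simp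
  define D where "D = b @ K @ u"
  have D: "D \<noteq> []" "hd D = x" using b by (auto simp: D_def)
  have "adj (D @ [x]) = adj (b @ [s]) \<union> (adj (K @ [s]) \<union> adj (u @ [x]))"
    using adj_glue[of "K @ u @ [x]" b] adj_glue[of "u @ [x]" K] KKs p(2) by (simp add: D_def)
  then have adj_D: "adj (D @ [x]) = E" using adj_K b ux by auto
  interpret D: covering_loop V E x D
    using D adj_D by unfold_locales auto
  have "hd (u @ b @ K) = s" using p(2) b by (cases u) auto
  moreover have "adj ((u @ b @ K) @ [s]) \<subseteq> E"
    using adj_glue[of "b @ K @ [s]" u] adj_glue[of "K @ [s]" b] KKs b ux adj_K by auto
  ultimately have w: "loop E s (u @ b @ K)" by (simp add: loop_def)
  have *: "V (u @ x # v) = V (u @ (D @ D @ [x]) @ v)"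
  proof -
    have "u @ (D @ D @ [x]) @ v = (u @ b @ K) @ (u @ b @ K) @ u @ x # v" by (simp add: D_def)
    moreover have "V ((u @ b @ K) @ (u @ b @ K) @ u @ x # v) = V (u @ x # v)"
      by (rule front_absorb[OF _ p(1) hd w]) simp
    ultimately show ?thesis by argo
  qed
  have p': "adj (u @ c @ c @ x # v) = E" using adj_insert_loop[OF c p(1)] adj_insert_loop[OF c, of "u @ c" v] by simp
  have hd': "hd (u @ c @ c @ x # v) = s"
    using p(2) c by (cases u; cases c) (auto simp: loop_def)
  have "u @ (D @ D) @ (c @ c) @ x # v = (u @ b @ K) @ (u @ b @ K) @ u @ c @ c @ x # v"
    by (simp add: D_def)
  moreover have "V ((u @ b @ K) @ (u @ b @ K) @ u @ c @ c @ x # v) = V (u @ c @ c @ x # v)"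
    by (rule front_absorb[OF _ p' hd' w]) simp
  ultimately have "V (u @ c @ c @ x # v) = V (u @ (D @ D) @ (c @ c) @ x # v)" by argo
  also have "\<dots> = V (u @ (c @ c @ D @ D @ [x]) @ v)"
    using D.loop_commute[OF loop_append[OF D.loop_K D.loop_K] loop_append[OF c c], of "x # v" u] by simp
  also have "\<dots> = V (u @ (D @ D @ [x]) @ v)" using ctx[OF D.absorb[OF c]] .
  finally show ?thesis using * by simp
qed

end

section \<open>Potentials of edge loops\<close>

text \<open>
  \<open>alternating E P y l y'\<close>: the edges of an alternating path \<open>y \<leftarrow> x\<^sub>1 \<rightarrow> y\<^sub>1 \<leftarrow> x\<^sub>2 \<rightarrow> \<dots> \<rightarrow> y'\<close> carry the product
  \<open>l\<close> of the words that \<open>P\<close> assigns to them.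
\<close>

inductive alternating :: "('a \<times> 'a) set \<Rightarrow> ('a \<Rightarrow> 'a \<Rightarrow> 'c list) \<Rightarrow> 'a \<Rightarrow> 'c list \<Rightarrow> 'a \<Rightarrow> bool"
  for E P where
  start: "alternating E P y [] y"
| extend: "alternating E P y l y' \<Longrightarrow> (x, y') \<in> E \<Longrightarrow> (x, y'') \<in> E \<Longrightarrow>
    alternating E P y (l @ P x y' @ P x y'') y''"

lemma alternating_append:
  assumes "alternating E P y' l' y''" "alternating E P y l y'"
  shows "alternating E P y (l @ l') y''"
  using assms
proof (induction rule: alternating.induct)
  case (extend y' l' z x z')
  then show ?case using alternating.extend[of E P y "l @ l'" z x z'] by simp
qed simp

fun chain :: "('a \<Rightarrow> 'c list) \<Rightarrow> ('a \<Rightarrow> 'a \<Rightarrow> 'c list) \<Rightarrow> 'a list \<Rightarrow> 'c list" where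
  "chain g P [] = []"
| "chain g P [x] = g x"
| "chain g P (x # y # w) = g x @ P x y @ chain g P (y # w)"

text \<open>
  Regrouping: the exit \<open>a x\<close> of a letter and the entrance \<open>b y\<close> of the next one together form the
  loop of the edge \<open>xy\<close>.
\<close>

lemma concat_eq_chain:
  assumes "w \<noteq> []" "P = (\<lambda>x y. a x @ b y)"
  shows "concat (map (\<lambda>x. b x @ g x @ a x) w) = b (hd w) @ chain g P w @ a (last w)"
  using assms(1)
proof (induction w rule: induct_list012)
  case (3 x y w)
  then show ?case by (simp add: assms(2))
qed (use assms in auto)

context covering_loop
begin

text \<open>
  On loops at \<open>s\<close> this is a congruence whose quotient is an abelian group of exponent $2$. It is handled
  through \<open>concat_eqv_if_same_parity\<close>: only the parity of each factor counts.
\<close>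

definition eqv :: "'a list \<Rightarrow> 'a list \<Rightarrow> bool" (infix "\<approx>" 50) where
  "l \<approx> l' \<longleftrightarrow> V (l @ K @ K @ [s]) = V (l' @ K @ K @ [s])"

lemma eqv_refl [simp]: "l \<approx> l"
  and eqv_sym: "l \<approx> l' \<Longrightarrow> l' \<approx> l"
  and eqv_trans [trans]: "l \<approx> l' \<Longrightarrow> l' \<approx> l'' \<Longrightarrow> l \<approx> l''"
  by (simp_all add: eqv_def)

lemma eqv_append_left: "l \<approx> l' \<Longrightarrow> m @ l \<approx> m @ l'"
  using prefix_ctx[of "l @ K @ K @ [s]" "l' @ K @ K @ [s]" m] by (simp add: eqv_def)

lemma eqv_commute: "loop E s l \<Longrightarrow> loop E s m \<Longrightarrow> l @ m \<approx> m @ l"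
  using loop_commute[of l m "K @ K @ [s]" "[]"] KKs by (simp add: eqv_def)

lemma eqv_double: "loop E s l \<Longrightarrow> m @ l @ l \<approx> m"
  using prefix_ctx[OF absorb[of l], of m] by (simp add: eqv_def)

lemma eqv_append_right:
  assumes "l \<approx> l'" "loop E s l" "loop E s l'" "loop E s m"
  shows "l @ m \<approx> l' @ m"
proof -
  have "l @ m \<approx> m @ l" using assms eqv_commute by blast
  also have "m @ l \<approx> m @ l'" using assms(1) by (rule eqv_append_left)
  also have "m @ l' \<approx> l' @ m" using assms eqv_commute by blast
  finally show ?thesis .
qed

lemma concat_even_eqv_Nil:
  assumes "\<And>l. l \<in> set ls \<Longrightarrow> loop E s l" "\<And>l. even (count_list ls l)"
  shows "concat ls \<approx> []"
  using assms
proof (induction ls rule: length_induct)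
  case (1 ls)
  show ?case
  proof (cases ls)
    case (Cons l ms)
    have "odd (count_list ms l)" using 1(3)[of l] Cons by simp
    then have "l \<in> set ms" using count_notin by fastforce
    then obtain u v where uv: "ms = u @ l # v" by (meson split_list)
    have loops: "loop E s l" "loop E s (concat u)" "loop E s (concat v)"
      using 1(2) Cons uv by (auto intro: loop_concat)
    have "concat ls = l @ concat u @ l @ concat v" by (simp add: Cons uv)
    also have "\<dots> \<approx> l @ l @ concat u @ concat v"
      using eqv_append_left[of "concat u @ l @ concat v" "l @ concat u @ concat v" l]
        eqv_append_right[OF eqv_commute[of "concat u" l], of "concat v"] loops
      by (simp add: loop_append)
    also have "\<dots> \<approx> (concat u @ concat v) @ l @ l"
      using eqv_commute[of "l @ l" "concat u @ concat v"] loops by (simp add: loop_append)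
    also have "\<dots> \<approx> concat (u @ v)"
      using eqv_double[OF loops(1), of "concat u @ concat v"] by simp
    also have "concat (u @ v) \<approx> []"
    proof -
      have "even (count_list (u @ v) m)" for m using 1(3)[of m] by (auto simp: Cons uv split: if_splits)
      then show ?thesis using 1(1)[rule_format, of "u @ v"] 1(2) by (auto simp: Cons uv)
    qed
    finally show ?thesis .
  qed simp
qed

lemma concat_eqv_if_same_parity:
  assumes "\<And>l. l \<in> set ls \<union> set ms \<Longrightarrow> loop E s l"
    and "\<And>l. even (count_list ls l) = even (count_list ms l)"
  shows "concat ls \<approx> concat ms"
proof -
  have loops: "loop E s (concat ls)" "loop E s (concat ms)" using assms(1) by (auto intro: loop_concat)
  have "concat ls \<approx> concat ls @ concat ms @ concat ms"
    using eqv_double[OF loops(2)] eqv_sym by blast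
  also have "\<dots> = concat (ls @ ms) @ concat ms" by simp
  also have "\<dots> \<approx> [] @ concat ms"
  proof (rule eqv_append_right)
    show "concat (ls @ ms) \<approx> []" using assms by (intro concat_even_eqv_Nil) auto
  qed (use loops loop_append in auto)
  finally show ?thesis by simp
qed

context
  fixes a b :: "'a \<Rightarrow> 'a list" and P :: "'a \<Rightarrow> 'a \<Rightarrow> 'a list"
  assumes b: "\<And>x. x \<in> Field E \<Longrightarrow> b x \<noteq> []" and P: "P = (\<lambda>x y. a x @ b y)"
    and loop_P: "\<And>x y. (x, y) \<in> E \<Longrightarrow> loop E s (P x y)"
begin

lemma alternating_loop: "alternating E P y l y' \<Longrightarrow> loop E s l"
  by (induction rule: alternating.induct) (auto intro!: loop_append loop_P)

lemma alternating_reverse: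
  assumes "alternating E P y l y'"
  shows "\<exists>l'. alternating E P y' l' y \<and> l' \<approx> l"
  using assms
proof (induction rule: alternating.induct)
  case (start y)
  then show ?case using alternating.start by (intro exI[of _ "[]"]) auto
next
  case (extend y l y' x y'')
  then obtain l' where l': "alternating E P y' l' y" "l' \<approx> l" by blast
  have "alternating E P y'' ([] @ P x y'' @ P x y') y'"
    using extend by (intro alternating.intros)
  then have "alternating E P y'' (P x y'' @ P x y') y'" by simp
  from alternating_append[OF l'(1) this]
  have alt: "alternating E P y'' ((P x y'' @ P x y') @ l') y" .
  have loops: "loop E s (P x y')" "loop E s (P x y'')" "loop E s l" "loop E s l'"
    using extend loop_P alternating_loop l' by auto
  have "(P x y'' @ P x y') @ l' \<approx> (P x y'' @ P x y') @ l" using l'(2) by (rule eqv_append_left)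
  also have "(P x y'' @ P x y') @ l = concat [P x y'', P x y', l]" by simp
  also have "\<dots> \<approx> concat [l, P x y', P x y'']"
    using loops by (intro concat_eqv_if_same_parity) auto
  finally show ?case using alt by auto
qed

text \<open>
  The invariant that links alternating paths to products of squares: a step along the path appends
  \<open>a x @ b y' @ a x @ b y''\<close> to \<open>b y'\<close>, and the result is the square of \<open>b y' @ a x\<close>
  followed by \<open>b y''\<close>.
\<close>

lemma alternating_squares:
  assumes "alternating E P y l y'"
  shows "\<exists>us. [] \<notin> set us \<and> b y @ l = concat (map (\<lambda>u. u @ u) us) @ b y'"
  using assms
proof (induction rule: alternating.induct)
  case (start y)
  then show ?case by (intro exI[of _ "[]"]) auto
next
  case (extend y l y' x y'')
  then obtain us where us: "[] \<notin> set us" "b y @ l = concat (map (\<lambda>u. u @ u) us) @ b y'" by blast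
  have "b y' \<noteq> []" using extend.hyps b by (auto simp: Field_def)
  moreover have "b y @ l @ P x y' @ P x y'' = (concat (map (\<lambda>u. u @ u) us) @ b y') @ P x y' @ P x y''"
    using us(2) by (metis append_assoc)
  ultimately show ?case using us(1)
    by (intro exI[of _ "us @ [b y' @ a x]"]) (simp add: P)
qed

text \<open>
  For a closed path, \<open>b y @ l = F @ b y\<close> with a product \<open>F\<close> of squares. Hence the law for \<open>F\<close> moves to \<open>l\<close>, and
  \<open>l\<^sup>3 = l\<^sup>2\<close> forces \<open>l\<close> to be trivial in a group.
\<close>

lemma alternating_cycle:
  assumes alt: "alternating E P y l y" and E: "(x, y) \<in> E"
  shows "l \<approx> []"
proof -
  obtain us where us: "[] \<notin> set us" "b y @ l = concat (map (\<lambda>u. u @ u) us) @ b y"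
    using alternating_squares[OF alt] by blast
  define F where "F = concat (map (\<lambda>u. u @ u) us)"
  have F: "b y @ l = F @ b y" using us by (simp add: F_def)
  then have F2: "b y @ l @ l = F @ F @ b y" and F3: "b y @ l @ l @ l = F @ F @ F @ b y"
    by (metis append_assoc)+
  have "V (F @ F @ F) = V (F @ F)" using core[OF us(1) F_def] .
  \<comment> \<open>The prefix \<open>a x\<close> turns both sides into loops at \<open>s\<close>.\<close>
  from ctx[OF this, of "a x" "b y @ K @ K @ [s]"]
  have "V ((a x @ F @ F @ F @ b y) @ K @ K @ [s]) = V ((a x @ F @ F @ b y) @ K @ K @ [s])" by simp
  then have "P x y @ l @ l @ l \<approx> P x y @ l @ l" unfolding eqv_def by (simp add: P F2 F3)
  then have *: "P x y @ P x y @ l @ l @ l \<approx> P x y @ P x y @ l @ l" by (rule eqv_append_left)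
  have loops: "loop E s l" "loop E s (P x y)" using alternating_loop[OF alt] loop_P[OF E] by auto
  have "concat [l] \<approx> concat [P x y, P x y, l, l, l]"
    using loops by (intro concat_eqv_if_same_parity) auto
  also have "\<dots> \<approx> concat [P x y, P x y, l, l]" using * by simp
  also have "\<dots> \<approx> concat []" using loops by (intro concat_eqv_if_same_parity) auto
  finally show ?thesis by simp
qed

lemma alternating_unique:
  assumes "alternating E P y l z" "alternating E P y l' z" "(x, y) \<in> E"
  shows "l \<approx> l'"
proof -
  obtain m where m: "alternating E P z m y" "m \<approx> l'" using alternating_reverse[OF assms(2)] by blast
  have loops: "loop E s l" "loop E s l'" "loop E s m" using assms m alternating_loop by auto
  have "concat [l] \<approx> concat [l, m, m]" using loops by (intro concat_eqv_if_same_parity) auto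
  also have "concat [l, m, m] = (l @ m) @ m" by simp
  also have "\<dots> \<approx> [] @ m"
    using alternating_cycle[OF alternating_append[OF m(1) assms(1)] assms(3)] loops
    by (intro eqv_append_right) (auto simp: loop_append)
  also have "[] @ m \<approx> l'" using m by simp
  finally show ?thesis by simp
qed

text \<open>
  Fix a reference vertex in each class of vertices connected by alternating paths. The potential \<open>\<beta> y\<close> is the
  product along a path from \<open>y\<close> to the reference vertex, which does not depend on the path because
  cycles are trivial; \<open>\<alpha> x\<close> is then determined by any one edge leaving \<open>x\<close>.
\<close>

lemma potentials_exist:
  "\<exists>\<alpha> \<beta>. (\<forall>x. loop E s (\<alpha> x) \<and> loop E s (\<beta> x)) \<and> (\<forall>(x, y)\<in>E. P x y \<approx> \<alpha> x @ \<beta> y)"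
proof -
  define r where "r y = (SOME r. \<exists>l. alternating E P y l r)" for y
  define \<beta> where "\<beta> y = (SOME l. alternating E P y l (r y))" for y
  have \<beta>: "alternating E P y (\<beta> y) (r y)" for y
  proof -
    have "\<exists>r l. alternating E P y l r" by (intro exI) (rule alternating.start)
    then have "\<exists>l. alternating E P y l (r y)" unfolding r_def by (rule someI_ex)
    then show ?thesis unfolding \<beta>_def by (rule someI_ex)
  qed
  have r: "r y = r y'" if "alternating E P y l y'" for y l y'
  proof -
    have "(\<exists>l. alternating E P y l z) = (\<exists>l. alternating E P y' l z)" for z
      using that alternating_append alternating_reverse by meson
    then show ?thesis by (simp add: r_def)
  qed
  define out where "out x = (SOME y. (x, y) \<in> E)" for x
  define \<alpha> where "\<alpha> x = (if x \<in> Domain E then P x (out x) @ \<beta> (out x) else [])" for x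
  have out: "(x, out x) \<in> E" if "x \<in> Domain E" for x
    using that unfolding out_def by (auto intro: someI)
  have loop_\<beta>: "loop E s (\<beta> y)" for y using alternating_loop \<beta> by blast
  have loop_\<alpha>: "loop E s (\<alpha> x)" for x
    using loop_append[OF loop_P[OF out] loop_\<beta>] by (simp add: \<alpha>_def)
  have "P x y \<approx> \<alpha> x @ \<beta> y" if xy: "(x, y) \<in> E" for x y
  proof -
    define z where "z = out x"
    have z: "(x, z) \<in> E" "\<alpha> x = P x z @ \<beta> z" using out xy by (auto simp: z_def \<alpha>_def)
    have "alternating E P y ([] @ P x y @ P x z) z" using xy z by (intro alternating.intros)
    then have yz: "alternating E P y (P x y @ P x z) z" by simp
    have "alternating E P y ((P x y @ P x z) @ \<beta> z) (r y)"
      using alternating_append[OF \<beta>[of z] yz] r[OF yz] by simp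
    then have \<beta>y: "\<beta> y \<approx> (P x y @ P x z) @ \<beta> z" using alternating_unique[OF \<beta> _ xy] by blast
    have loops: "loop E s (P x y)" "loop E s (P x z)" "loop E s (\<beta> z)"
      using loop_P xy z loop_\<beta> by auto
    have "concat [P x y] \<approx> concat [P x z, \<beta> z, P x y, P x z, \<beta> z]"
      using loops by (intro concat_eqv_if_same_parity) auto
    also have "\<dots> = (P x z @ \<beta> z) @ (P x y @ P x z) @ \<beta> z" by simp
    also have "\<dots> \<approx> (P x z @ \<beta> z) @ \<beta> y" using \<beta>y by (rule eqv_append_left[OF eqv_sym])
    finally show ?thesis using z by simp
  qed
  then show ?thesis using loop_\<alpha> loop_\<beta> by (intro exI[of _ \<alpha>] exI[of _ \<beta>]) auto
qed

end

lemma insert_double_loops: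
  assumes "\<And>x. x \<in> Field E \<Longrightarrow> loop E x (c x)" "adj (u @ v) = E" "hd (u @ v) = s"
  shows "V (u @ concat (map (\<lambda>x. c x @ c x @ [x]) v)) = V (u @ v) \<and>
    adj (u @ concat (map (\<lambda>x. c x @ c x @ [x]) v)) = E"
  using assms(2,3)
proof (induction v arbitrary: u)
  case (Cons x v)
  have "E \<noteq> {}" using adj_K K_nonempty by (auto simp: adj_append)
  then have "x \<in> Field E" using Cons.prems set_eq_Field[of "u @ x # v"] by auto
  then have c: "loop E x (c x)" using assms by blast
  have adj: "adj (u @ c x @ c x @ x # v) = E"
    using adj_insert_loop[OF c Cons.prems(1)] adj_insert_loop[OF c, of "u @ c x" v] by simp
  have hd: "hd (u @ c x @ c x @ x # v) = s" "hd (u @ [x]) = s"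
    using Cons.prems(2) c by (cases u; cases "c x"; auto simp: loop_def)+
  have "V (u @ c x @ c x @ x # v) = V (u @ x # v)"
    using insert_double_loop[OF Cons.prems(1) hd(2) c] .
  then show ?case using Cons.IH[of "u @ c x @ c x @ [x]"] adj hd by simp
qed simp

text \<open>
  Potentials turn each edge loop into contributions of its two letters. Every letter receives the same
  contribution \<open>\<beta> x @ g x @ \<alpha> x\<close>, except that the first one lacks \<open>\<beta>\<close> and the last one lacks \<open>\<alpha>\<close>; the
  extra factors correct this.
\<close>

lemma chain_eqv:
  assumes "w \<noteq> []" "adj w \<subseteq> E"
    and loops: "\<And>x. x \<in> set w \<Longrightarrow> loop E s (g x)" "\<And>x. loop E s (\<alpha> x)" "\<And>x. loop E s (\<beta> x)"
      "\<And>x y. (x, y) \<in> E \<Longrightarrow> loop E s (P x y)"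
    and P: "\<And>x y. (x, y) \<in> E \<Longrightarrow> P x y \<approx> \<alpha> x @ \<beta> y"
  shows "loop E s (chain g P w) \<and>
    chain g P w \<approx> concat (\<beta> (hd w) # \<alpha> (last w) # map (\<lambda>x. \<beta> x @ g x @ \<alpha> x) w)"
  using assms(1,2) loops(1)
proof (induction w rule: induct_list012)
  case (2 x)
  then have "concat [g x] \<approx> concat [\<beta> x, \<alpha> x, \<beta> x, g x, \<alpha> x]"
    using loops by (intro concat_eqv_if_same_parity) auto
  then show ?case using 2 by simp
next
  case (3 x y w)
  define H where "H = concat (map (\<lambda>x. \<beta> x @ g x @ \<alpha> x) (y # w))"
  have IH: "loop E s (chain g P (y # w))"
    "chain g P (y # w) \<approx> \<beta> y @ \<alpha> (last (y # w)) @ H"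
    using 3 by (auto simp: H_def)
  have xy: "(x, y) \<in> E" using 3 by auto
  have lH: "loop E s H"
    unfolding H_def using "3.prems" loops by (intro loop_concat) (auto intro!: loop_append)
  have l: "loop E s (chain g P (x # y # w))"
    using 3 IH loops xy by (auto intro!: loop_append)
  have "chain g P (x # y # w) = g x @ P x y @ chain g P (y # w)" by simp
  also have "\<dots> \<approx> g x @ P x y @ (\<beta> y @ \<alpha> (last (y # w)) @ H)"
    using IH(2) by (intro eqv_append_left)
  also have "\<dots> \<approx> g x @ (\<alpha> x @ \<beta> y) @ (\<beta> y @ \<alpha> (last (y # w)) @ H)"
    using P[OF xy] loops xy lH by (intro eqv_append_left eqv_append_right) (auto intro!: loop_append)
  also have "\<dots> = concat [g x, \<alpha> x, \<beta> y, \<beta> y, \<alpha> (last (y # w)), H]" by simp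
  also have "\<dots> \<approx> concat [\<beta> x, \<alpha> (last (y # w)), \<beta> x, g x, \<alpha> x, H]"
    using 3 loops lH by (intro concat_eqv_if_same_parity) auto
  finally show ?case using l by (simp add: H_def)
qed simp

lemma count_list_map: "count_list (map h w) l = length (filter (\<lambda>x. h x = l) w)"
  by (induction w) auto

text \<open>
  The strongly connected case. Both words are expanded by doubled loops at each letter, with the same
  choice of paths from and to the base letter; what remains between the ends is a product of loops that
  depends on the parities of the letters.
\<close>

theorem similar_covering_words:
  assumes pq: "similar p q" and p: "adj p = E" "hd p = s"
  shows "V p = V q"
proof -
  have q: "adj q = E" "hd q = s" "last q = last p" and ne: "p \<noteq> []" "q \<noteq> []" and set: "set q = set p"
    using pq p by (auto simp: similar_def)
  have E: "E \<noteq> {}" using adj_K K_nonempty by (auto simp: adj_append)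
  have Field: "set p = Field E" using E p set_eq_Field by blast
  obtain a where a: "\<And>x. x \<in> Field E \<Longrightarrow> a x \<noteq> [] \<and> hd (a x) = s \<and> last (a x) = x \<and> adj (a x) \<subseteq> E"
    using walk_from_base by metis
  obtain b where b: "\<And>x. x \<in> Field E \<Longrightarrow> b x \<noteq> [] \<and> hd (b x) = x \<and> adj (b x @ [s]) \<subseteq> E"
    using walk_to_base by metis
  define P where "P = (\<lambda>x y. a x @ b y)"
  define g where "g x = a x @ tl (b x)" for x
  \<comment> \<open>The loop \<open>c x\<close> at \<open>x\<close> runs to the base letter and back. The middle part of its double, from base
  to base, is \<open>g x\<close>.\<close>
  define c where "c x = b x @ butlast (a x)" for x
  have a': "a x = butlast (a x) @ [x]" and b': "b x = x # tl (b x)" if "x \<in> Field E" for x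
    using a[OF that] b[OF that] by (metis append_butlast_last_id, metis list.collapse)
  have loop_P: "loop E s (P x y)" if xy: "(x, y) \<in> E" for x y
  proof -
    have x: "x \<in> Field E" "y \<in> Field E" using xy by (auto simp: Field_def)
    have "adj (a x @ b y @ [s]) = adj (a x) \<union> {(x, y)} \<union> adj (b y @ [s])"
      using adj_append[of "a x" "b y @ [s]"] a[OF x(1)] b[OF x(2)] by auto
    then show ?thesis using xy a[OF x(1)] b[OF x(2)] by (auto simp: loop_def P_def)
  qed
  have loop_g: "loop E s (g x)" if x: "x \<in> Field E" for x
  proof -
    have "g x @ [s] = butlast (a x) @ (b x @ [s])" using a'[OF x] b'[OF x] by (metis append.assoc append_Cons append_Nil g_def)
    then have "adj (g x @ [s]) = adj (a x) \<union> adj (b x @ [s])"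
      using adj_glue[of "b x @ [s]" "butlast (a x)"] a'[OF x] b[OF x] by simp
    then show ?thesis using a[OF x] b[OF x] by (simp add: loop_def g_def)
  qed
  have loop_c: "loop E x (c x)" if x: "x \<in> Field E" for x
  proof -
    have "c x @ [x] = b x @ a x" using a'[OF x] by (simp add: c_def)
    then have "adj (c x @ [x]) = adj (b x @ [s]) \<union> adj (a x)"
      using adj_glue[of "a x" "b x"] a[OF x] by simp
    then show ?thesis using a[OF x] b[OF x] by (simp add: loop_def c_def)
  qed
  have c: "c x @ c x @ [x] = b x @ g x @ a x" if x: "x \<in> Field E" for x
    using a'[OF x] b'[OF x] unfolding c_def g_def by (metis append.assoc append_Cons append_Nil)
  obtain \<alpha> \<beta> where "\<forall>x. loop E s (\<alpha> x) \<and> loop E s (\<beta> x)"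
      "\<forall>(x, y)\<in>E. P x y \<approx> \<alpha> x @ \<beta> y"
    using potentials_exist[OF _ P_def loop_P] b by meson
  then have potential: "loop E s (\<alpha> x)" "loop E s (\<beta> x)"
      "(x, y) \<in> E \<Longrightarrow> P x y \<approx> \<alpha> x @ \<beta> y" for x y
    by auto
  define t where "t = last p"
  have t: "t \<in> Field E" using ne Field last_in_set[of p] by (simp add: t_def)
  have expand: "V w = V (b s @ chain g P w @ K @ K @ a t)"
    if w: "adj w = E" "hd w = s" "last w = t" "w \<noteq> []" "set w = Field E" for w
  proof -
    have "concat (map (\<lambda>x. c x @ c x @ [x]) w) = concat (map (\<lambda>x. b x @ g x @ a x) w)"
      using c w(5) by (intro arg_cong[where f = concat] map_cong) auto
    also have "\<dots> = b s @ chain g P w @ a t"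
      using concat_eq_chain[OF w(4) P_def, of g] w by simp
    finally have *: "V (b s @ chain g P w @ a t) = V w" "adj (b s @ chain g P w @ a t) = E"
      using insert_double_loops[of c "[]" w] loop_c w by auto
    have s: "s \<in> Field E" using w by (metis hd_in_set)
    have at: "a t = s # tl (a t)" using a[OF t] by (metis list.collapse)
    have "V ((b s @ chain g P w) @ K @ K @ s # tl (a t)) = V ((b s @ chain g P w) @ s # tl (a t))"
      using insert_double_loop[of "b s @ chain g P w" s "tl (a t)" K] *(2) at b[OF s] loop_K by simp
    then show ?thesis using * at by simp
  qed
  have chain: "loop E s (chain g P w)"
    "chain g P w \<approx> concat (\<beta> s # \<alpha> t # map (\<lambda>x. \<beta> x @ g x @ \<alpha> x) w)"
    if "adj w = E" "hd w = s" "last w = t" "w \<noteq> []" "set w = Field E" for w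
    using chain_eqv[of w g \<alpha> \<beta> P] that potential loop_P loop_g by auto
  have "chain g P p \<approx> concat (\<beta> s # \<alpha> t # map (\<lambda>x. \<beta> x @ g x @ \<alpha> x) p)"
    using chain(2)[of p] p ne Field by (simp add: t_def)
  also have "\<dots> \<approx> concat (\<beta> s # \<alpha> t # map (\<lambda>x. \<beta> x @ g x @ \<alpha> x) q)"
  proof (rule concat_eqv_if_same_parity)
    show "loop E s l" if "l \<in> set (\<beta> s # \<alpha> t # map (\<lambda>x. \<beta> x @ g x @ \<alpha> x) p) \<union>
      set (\<beta> s # \<alpha> t # map (\<lambda>x. \<beta> x @ g x @ \<alpha> x) q)" for l
      using that potential loop_g Field set by (auto intro!: loop_append)
    show "even (count_list (\<beta> s # \<alpha> t # map (\<lambda>x. \<beta> x @ g x @ \<alpha> x) p) l) =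
      even (count_list (\<beta> s # \<alpha> t # map (\<lambda>x. \<beta> x @ g x @ \<alpha> x) q) l)" for l
      using similar_filter_parity[OF pq] by (simp add: count_list_map)
  qed
  also have "\<dots> \<approx> chain g P q"
    using chain(2)[of q] q ne Field set eqv_sym by (simp add: t_def)
  finally have "V (chain g P p @ K @ K @ [s]) = V (chain g P q @ K @ K @ [s])" by (simp add: eqv_def)
  then have "V (b s @ (chain g P p @ K @ K @ [s]) @ tl (a t)) = V (b s @ (chain g P q @ K @ K @ [s]) @ tl (a t))"
    by (rule ctx)
  moreover have "a t = s # tl (a t)" using a[OF t] by (metis list.collapse)
  ultimately have "V (b s @ chain g P p @ K @ K @ a t) = V (b s @ chain g P q @ K @ K @ a t)" by simp
  then show ?thesis using expand[of p] expand[of q] p q ne Field set by (simp add: t_def)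
qed

end

section \<open>Splitting a walk at strongly connected components\<close>

text \<open>
  A walk that has left \<open>C\<close> cannot return.
\<close>

lemma closed_predecessors_split:
  assumes "\<And>x y. (x, y) \<in> adj w \<Longrightarrow> y \<in> C \<Longrightarrow> x \<in> C"
  shows "w = filter (\<lambda>x. x \<in> C) w @ filter (\<lambda>x. x \<notin> C) w"
  using assms
proof (induction w)
  case (Cons x w)
  have IH: "w = filter (\<lambda>x. x \<in> C) w @ filter (\<lambda>x. x \<notin> C) w"
    using Cons by (cases "w = []") (auto simp: adj_Cons)
  show ?case
  proof (cases "x \<in> C")
    case False
    have "filter (\<lambda>x. x \<in> C) w = []"
    proof (rule ccontr)
      assume ne: "filter (\<lambda>x. x \<in> C) w \<noteq> []"
      then have "hd w = hd (filter (\<lambda>x. x \<in> C) w)" by (metis IH hd_append2)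
      then have "hd w \<in> C" using hd_in_set[OF ne] by auto
      moreover have "w \<noteq> []" using ne by auto
      ultimately show False using Cons.prems[of x "hd w"] False by (simp add: adj_Cons)
    qed
    then show ?thesis using IH False by simp
  qed (use IH in simp)
qed simp

lemma count_list_filter: "count_list (filter Q w) x = (if Q x then count_list w x else 0)"
  by (induction w) auto

lemma rtrancl_walk:
  assumes "(x, s) \<in> E\<^sup>*"
  shows "\<exists>w. w \<noteq> [] \<and> hd w = x \<and> last w = s \<and> adj w \<subseteq> E \<inter> {x. (x, s) \<in> E\<^sup>*} \<times> {x. (x, s) \<in> E\<^sup>*}"
  using assms
proof (induction rule: converse_rtrancl_induct)
  case base
  then show ?case by (intro exI[of _ "[s]"]) auto
next
  case (step x y)
  then obtain w where w: "w \<noteq> []" "hd w = y" "last w = s"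
    "adj w \<subseteq> E \<inter> {x. (x, s) \<in> E\<^sup>*} \<times> {x. (x, s) \<in> E\<^sup>*}" by blast
  have "(x, s) \<in> E\<^sup>*" using step by (meson converse_rtrancl_into_rtrancl)
  then show ?case using w step by (intro exI[of _ "x # w"]) (auto simp: adj_Cons)
qed

context loop_congruence
begin

text \<open>
  Let \<open>C\<close> be the component of the first letter, that is, the letters from which it can be reached. The walk
  first stays in \<open>C\<close> and then never returns; the edge set determines the only edge leaving \<open>C\<close>, so that
  both parts of similar words are similar. The second part is shorter.
\<close>

theorem similar_imp_equal:
  assumes "similar p q"
  shows "V p = V q"
  using assms
proof (induction "length p" arbitrary: p q rule: less_induct)
  case less
  define E where "E = adj p"
  define s where "s = hd p"
  define C where "C = {x. (x, s) \<in> E\<^sup>*}"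
  have pq: "p \<noteq> []" "q \<noteq> []" "hd q = s" "last q = last p" "set q = set p" "adj q = E"
      "even (count_list p x) = even (count_list q x)" for x
    using less.prems by (auto simp: similar_def E_def s_def)
  have pred: "x \<in> C" if "(x, y) \<in> E" "y \<in> C" for x y
    using that by (auto simp: C_def intro: converse_rtrancl_into_rtrancl)
  let ?in = "filter (\<lambda>x. x \<in> C)" and ?out = "filter (\<lambda>x. x \<notin> C)"
  have split: "w = ?in w @ ?out w" if "adj w = E" for w
    using closed_predecessors_split pred that by metis
  have s: "s \<in> C" by (simp add: C_def)
  have in_w: "?in w \<noteq> []" "hd (?in w) = s" "adj (?in w) = E \<inter> C \<times> C" "adj (?out w) = E \<inter> (- C) \<times> (- C)"
    "?out w \<noteq> [] \<Longrightarrow> E \<inter> C \<times> (- C) = {(last (?in w), hd (?out w))}"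
    "?out w \<noteq> [] \<Longrightarrow> last (?out w) = last w" "?out w = [] \<Longrightarrow> ?in w = w"
    if w: "adj w = E" "hd w = s" "w \<noteq> []" for w
  proof -
    have sp: "w = ?in w @ ?out w" using split w by blast
    show ne: "?in w \<noteq> []"
    proof -
      have "s \<in> set w" using w hd_in_set by blast
      then show ?thesis using s by (auto simp: filter_empty_conv)
    qed
    then show "hd (?in w) = s" using sp w by (metis hd_append2)
    have sub: "adj (?in w) \<subseteq> C \<times> C" "adj (?out w) \<subseteq> (- C) \<times> (- C)"
      using adj_subset_set[of "?in w"] adj_subset_set[of "?out w"] by auto
    have "last (?in w) \<in> C" using last_in_set[OF ne] by auto
    moreover have "hd (?out w) \<in> - C" if "?out w \<noteq> []"
      using hd_in_set[OF that] by auto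
    moreover have E: "E = adj (?in w) \<union> adj (?out w) \<union> (if ?out w = [] then {} else {(last (?in w), hd (?out w))})"
    proof (cases "?out w = []")
      case True
      then show ?thesis using sp w by simp
    next
      case False
      then show ?thesis using adj_append[OF ne False] sp w by simp
    qed
    ultimately show "adj (?in w) = E \<inter> C \<times> C" "adj (?out w) = E \<inter> (- C) \<times> (- C)"
      "?out w \<noteq> [] \<Longrightarrow> E \<inter> C \<times> (- C) = {(last (?in w), hd (?out w))}"
      using sub by (auto split: if_splits)
    show "?out w \<noteq> [] \<Longrightarrow> last (?out w) = last w" "?out w = [] \<Longrightarrow> ?in w = w"
      using sp by (metis last_appendR, metis append_Nil2)
  qed
  have p: "adj p = E" "hd p = s" by (simp_all add: E_def s_def)
  note in_p = in_w[OF p pq(1)] and in_q = in_w[OF pq(6,3,2)]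
  have out_iff: "?out p = [] \<longleftrightarrow> ?out q = []" using pq(5) by (simp add: filter_empty_conv)
  have parity: "even (count_list (filter Q p) x) = even (count_list (filter Q q) x)" for Q x
    using pq(7) by (simp add: count_list_filter)
  have "last (?in p) = last (?in q)"
    using in_p(5,7) in_q(5,7) out_iff pq(4) by (cases "?out p = []") auto
  then have sim_in: "similar (?in p) (?in q)"
    using in_p in_q parity pq(5) by (auto simp: similar_def)
  have "V (?in p) = V (?in q)"
  proof (cases "E \<inter> C \<times> C = {}")
    case True
    have single: "w = [s]" if "w \<noteq> []" "hd w = s" "adj w = {}" for w
      using that by (cases w rule: remdups_adj.cases) auto
    show ?thesis
      using single[OF in_p(1,2)] single[OF in_q(1,2)] in_p(3) in_q(3) True by simp
  next
    case False
    define p1 where "p1 = ?in p"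
    have p1: "p1 \<noteq> []" "hd p1 = s" "adj p1 = E \<inter> C \<times> C" using in_p by (simp_all add: p1_def)
    have "last p1 \<in> set p1" using p1 by simp
    then have "(last p1, s) \<in> E\<^sup>*" by (simp add: p1_def C_def)
    then obtain R where R: "R \<noteq> []" "hd R = last p1" "last R = s" "adj R \<subseteq> E \<inter> C \<times> C"
      using rtrancl_walk[of "last p1" s E] by (auto simp: C_def)
    \<comment> \<open>The walk \<open>p1\<close> followed by a return path \<open>R\<close>, with the shared letter and the final \<open>s\<close> dropped.\<close>
    define K where "K = butlast p1 @ butlast R"
    have Ks: "K @ [s] = butlast p1 @ R" using R(1,3) by (simp add: K_def) (metis append_butlast_last_id)
    have adj_K: "adj (K @ [s]) = adj p1"
      using adj_glue[of R "butlast p1"] R p1 by (auto simp: Ks)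
    then have "K \<noteq> []" using False p1 by auto
    moreover have "hd (butlast p1 @ R) = s" using p1 R(2) by (cases p1 rule: remdups_adj.cases) auto
    ultimately interpret covering_loop V "adj p1" s K
      using adj_K Ks by unfold_locales (auto simp: hd_append split: if_splits, metis hd_append2)
    show ?thesis using similar_covering_words sim_in p1(2) by (simp add: p1_def)
  qed
  moreover have "V (?out p) = V (?out q)"
  proof (cases "?out p = []")
    case True
    then show ?thesis using out_iff by simp
  next
    case False
    then have "hd (?out p) = hd (?out q)" using in_p(5) in_q(5) out_iff by auto
    then have "similar (?out p) (?out q)"
      using in_p in_q parity pq False out_iff by (auto simp: similar_def)
    moreover have "length p = length (?in p) + length (?out p)" using split[OF p(1)] by (metis length_append)
    then have "length (?out p) < length p" using in_p(1) by simp
    ultimately show ?thesis using less.hyps by blast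
  qed
  ultimately have "V (?in p @ ?out p) = V (?in q @ ?out q)"
    using ctx[of "?in p" "?in q" "[]" "?out p"] prefix_ctx[of "?out p" "?out q" "?in q"] by simp
  then show ?case using split[OF p(1)] split[OF pq(6)] by simp
qed

end

section \<open>A criterion for membership in the variety of $AC_2$\<close>

text \<open>
  The subsemigroup generated by the squares. If $z^4 = z^2$ holds, then the squares are exactly the
  idempotents.
\<close>

inductive_set square_products :: "'a set \<Rightarrow> ('a \<Rightarrow> 'a \<Rightarrow> 'a) \<Rightarrow> 'a set" for S f where
  square: "x \<in> S \<Longrightarrow> f x x \<in> square_products S f"
| times_square: "w \<in> square_products S f \<Longrightarrow> x \<in> S \<Longrightarrow> f w (f x x) \<in> square_products S f"

text \<open>
  In this order: $xyxyxyx = xyx$, $x \cdot xyx = xyx \cdot x$, $xyxzx = xzxyx$ and $z^4 = z^2$. They express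
  that loops \<open>w, w'\<close> at \<open>x\<close> satisfy $w^3x = wx$ and $ww'x = w'wx$, with the cases where $w$ or $w'$ is
  the single letter $x$ as separate laws. The products are bracketed in the way in which they are
  computed below.
\<close>

definition loop_laws :: "('a \<Rightarrow> 'a \<Rightarrow> 'a) \<Rightarrow> 'a \<Rightarrow> 'a \<Rightarrow> 'a \<Rightarrow> bool" where
  "loop_laws f x y z \<longleftrightarrow>
     f (f (f x y) (f x y)) (f (f x y) x) = f (f x y) x \<and>
     f x (f (f x y) x) = f (f (f x y) x) x \<and>
     f (f (f x y) x) (f z x) = f (f x z) (f (f x y) x) \<and>
     f (f z z) (f z z) = f z z"

definition ac2_criterion :: "'a set \<Rightarrow> ('a \<Rightarrow> 'a \<Rightarrow> 'a) \<Rightarrow> bool" where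
  "ac2_criterion S f \<longleftrightarrow> (\<forall>x\<in>S. \<forall>y\<in>S. \<forall>z\<in>S. loop_laws f x y z) \<and>
     (\<forall>w\<in>square_products S f. f (f w w) w = f w w)"

lemma square_products_subset:
  "semigroup_on S f \<Longrightarrow> square_products S f \<subseteq> S"
proof
  fix w assume "semigroup_on S f" "w \<in> square_products S f"
  from this(2,1) show "w \<in> S" by induction (auto simp: semigroup_on_def)
qed

lemma criterion_loop_congruence:
  assumes S: "semigroup_on S f" and crit: "ac2_criterion S f" and \<phi>: "range \<phi> \<subseteq> S"
  shows "loop_congruence (\<lambda>w. if w = [] then None else Some (word_value f \<phi> w))"
proof
  let ?v = "word_value f \<phi>"
  note app = word_value_append[OF S \<phi>]
  fix u w a b :: "nat list"
  assume "(if u = [] then None else Some (?v u)) = (if w = [] then None else Some (?v w))"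
  then have *: "(u = []) = (w = [])" "u \<noteq> [] \<Longrightarrow> ?v u = ?v w" by (auto split: if_splits)
  show "(if a @ u @ b = [] then None else Some (?v (a @ u @ b))) =
      (if a @ w @ b = [] then None else Some (?v (a @ w @ b)))"
  proof (cases "u = []")
    case False
    then have "w \<noteq> []" using * by simp
    then show ?thesis using False * by (cases "a = []"; cases "b = []") (simp_all add: app)
  qed (use * in simp)
next
  let ?v = "word_value f \<phi>"
  note app = word_value_append[OF S \<phi>]
  have v: "?v w \<in> S" if "w \<noteq> []" for w using word_value_closed[OF S \<phi> that] .
  have \<phi>S: "\<phi> x \<in> S" for x using \<phi> by auto
  have cl: "f x y \<in> S" if "x \<in> S" "y \<in> S" for x y using S that by (simp add: semigroup_on_def)
  have as: "f (f x y) z = f x (f y z)" if "x \<in> S" "y \<in> S" "z \<in> S" for x y z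
    using S that by (simp add: semigroup_on_def)
  have laws: "f x (f y (f x (f y (f x (f y x))))) = f x (f y x)"
    "f x (f y (f x (f z x))) = f x (f z (f x (f y x)))"
    "f x (f x (f y x)) = f x (f y (f x x))"
    "f x (f x (f x x)) = f x x"
    if "x \<in> S" "y \<in> S" "z \<in> S" for x y z
    using crit that unfolding ac2_criterion_def loop_laws_def by (auto simp: as cl)
  fix x A
  show "(if x # A @ x # A @ x # A @ [x] = [] then None else Some (?v (x # A @ x # A @ x # A @ [x]))) =
      (if x # A @ [x] = [] then None else Some (?v (x # A @ [x])))"
    using laws(1)[of "\<phi> x" "?v A" "\<phi> x"] laws(4)[of "\<phi> x" "\<phi> x" "\<phi> x"]
    by (cases "A = []") (simp_all add: app word_value_Cons v \<phi>S cl as)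
  fix B
  show "(if x # A @ x # B @ [x] = [] then None else Some (?v (x # A @ x # B @ [x]))) =
      (if x # B @ x # A @ [x] = [] then None else Some (?v (x # B @ x # A @ [x])))"
    using laws(2)[of "\<phi> x" "?v A" "?v B"] laws(3)[of "\<phi> x" "?v B" "\<phi> x"]
      laws(3)[of "\<phi> x" "?v A" "\<phi> x"]
    by (cases "A = []"; cases "B = []") (simp_all add: app word_value_Cons v \<phi>S cl as)
next
  let ?v = "word_value f \<phi>"
  note app = word_value_append[OF S \<phi>]
  fix us :: "nat list list" and F
  assume us: "[] \<notin> set us" and F: "F = concat (map (\<lambda>u. u @ u) us)"
  have "us \<noteq> [] \<longrightarrow> concat (map (\<lambda>u. u @ u) us) \<noteq> [] \<and>
      ?v (concat (map (\<lambda>u. u @ u) us)) \<in> square_products S f"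
    using us
  proof (induction us rule: rev_induct)
    case (snoc u us)
    have "?v u \<in> S" using word_value_closed[OF S \<phi>] snoc by auto
    then have uu: "?v (u @ u) = f (?v u) (?v u)" "?v u \<in> S" "u \<noteq> []" using snoc app by auto
    show ?case
    proof (cases "us = []")
      case False
      then show ?thesis
        using snoc uu app[of "concat (map (\<lambda>u. u @ u) us)" "u @ u"]
        by (auto intro: square_products.times_square)
    qed (use uu in \<open>auto intro: square_products.square\<close>)
  qed simp
  then show "(if F @ F @ F = [] then None else Some (?v (F @ F @ F))) =
      (if F @ F = [] then None else Some (?v (F @ F)))"
    using crit square_products_subset[OF S] S
    by (cases "us = []") (auto simp: F app ac2_criterion_def semigroup_on_def subset_iff)
qed

lemma word_value_cong:
  "w \<noteq> [] \<Longrightarrow> (\<And>x. x \<in> set w \<Longrightarrow> \<phi> x = \<psi> x) \<Longrightarrow> word_value f \<phi> w = word_value f \<psi> w"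
  by (induction w rule: list_nonempty_induct) (auto simp: word_value_Cons)

text \<open>
  Each factor gets a variable of its own, which expresses $w^2 = w^3$ as an instance of an identity
  of $AC_2$.
\<close>

lemma square_products_values:
  assumes S: "semigroup_on S f" and w: "w \<in> square_products S f"
  shows "\<exists>n \<phi>. 0 < n \<and> range \<phi> \<subseteq> S \<and> w = word_value f \<phi> (squares_word n)"
  using w
proof (induction rule: square_products.induct)
  case (square x)
  then show ?case by (intro exI[of _ 1] exI[of _ "\<lambda>_. x"]) (auto simp: squares_word_def)
next
  case (times_square w x)
  then obtain n \<phi> where n: "0 < n" "range \<phi> \<subseteq> S" "w = word_value f \<phi> (squares_word n)" by blast
  define \<psi> where "\<psi> = \<phi>(n := x)"
  have \<psi>: "range \<psi> \<subseteq> S" using n times_square by (auto simp: \<psi>_def)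
  have "w = word_value f \<psi> (squares_word n)"
    unfolding n(3) using squares_word_props[OF n(1)]
    by (intro word_value_cong) (auto simp: \<psi>_def squares_word_def)
  then have "f w (f x x) = word_value f \<psi> (squares_word (Suc n))"
    using squares_word_props[OF n(1)]
    by (simp add: squares_word_Suc word_value_append[OF S \<psi>]) (simp add: \<psi>_def)
  then show ?case using \<psi> by blast
qed

text \<open>
  In one direction, all laws of the criterion are instances of identities of $AC_2$. In the other one, the
  criterion turns every substitution into a \<open>loop_congruence\<close>.
\<close>

theorem in_variety_ac2_iff:
  assumes S: "semigroup_on S f"
  shows "in_variety S f (UNIV :: ac2 set) ac2_mult \<longleftrightarrow> ac2_criterion S f"
proof
  assume crit: "ac2_criterion S f"
  have "satisfies S f e" if e: "is_identity e" "satisfies (UNIV :: ac2 set) ac2_mult e" for e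
    unfolding satisfies_def
  proof (intro allI impI)
    fix \<phi> :: "nat \<Rightarrow> 'a" assume \<phi>: "range \<phi> \<subseteq> S"
    interpret loop_congruence "\<lambda>w. if w = [] then None else Some (word_value f \<phi> w)"
      by (rule criterion_loop_congruence[OF S crit \<phi>])
    have "similar (fst e) (snd e)"
      using satisfies_ac2_similar[of "fst e" "snd e"] e by (simp add: is_identity_def)
    from similar_imp_equal[OF this] show "word_value f \<phi> (fst e) = word_value f \<phi> (snd e)"
      using e by (simp add: is_identity_def)
  qed
  then show "in_variety S f (UNIV :: ac2 set) ac2_mult" using S by (simp add: in_variety_def)
next
  assume var: "in_variety S f (UNIV :: ac2 set) ac2_mult"
  have eq: "word_value f \<phi> p = word_value f \<phi> q" if "similar p q" "range \<phi> \<subseteq> S" for p q \<phi>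
  proof -
    have "satisfies S f (p, q)"
      using var similar_satisfies_ac2[OF that(1)] that(1)
      by (auto simp: in_variety_def is_identity_def similar_def)
    then show ?thesis using that by (simp add: satisfies_def)
  qed
  have cl: "f x y \<in> S" if "x \<in> S" "y \<in> S" for x y using S that by (simp add: semigroup_on_def)
  have as: "f (f x y) z = f x (f y z)" if "x \<in> S" "y \<in> S" "z \<in> S" for x y z
    using S that by (simp add: semigroup_on_def)
  have "loop_laws f x y z" if xyz: "x \<in> S" "y \<in> S" "z \<in> S" for x y z
  proof -
    define \<phi> where "\<phi> i = (if i = 0 then x else if i = 1 then y else z)" for i :: nat
    have \<phi>: "range \<phi> \<subseteq> S" using xyz by (auto simp: \<phi>_def)
    have "similar [0, 1, 0, 1, 0, 1, 0] [0, 1, 0::nat]" "similar [0, 0, 1, 0] [0, 1, 0, 0::nat]"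
      "similar [0, 1, 0, 2, 0] [0, 2, 0, 1, 0::nat]" "similar [2, 2, 2, 2] [2, 2::nat]"
      by (auto simp: similar_def)
    from this[THEN eq, OF \<phi>] show ?thesis
      using xyz by (simp add: loop_laws_def as cl) (simp add: \<phi>_def)
  qed
  moreover have "f (f w w) w = f w w" if w: "w \<in> square_products S f" for w
  proof -
    obtain n \<phi> where n: "0 < n" "range \<phi> \<subseteq> S" "w = word_value f \<phi> (squares_word n)"
      using square_products_values[OF S w] by blast
    let ?W = "squares_word n"
    have "similar (?W @ ?W @ ?W) (?W @ ?W)"
      using squares_word_props[OF n(1)] by (auto simp: similar_def adj_append)
    from eq[OF this n(2)] show ?thesis
      using n squares_word_props[OF n(1)] square_products_subset[OF S] w
      by (auto simp: word_value_append[OF S n(2)] as subset_iff)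
  qed
  ultimately show "ac2_criterion S f" by (simp add: ac2_criterion_def)
qed

section \<open>Execution within a time bound\<close>

definition reaches ::
    "instr list \<Rightarrow> nat \<Rightarrow> (nat \<Rightarrow> nat \<Rightarrow> nat) \<Rightarrow> nat \<Rightarrow> config \<Rightarrow> (config \<Rightarrow> bool) \<Rightarrow> bool" where
  "reaches P n m k c Q \<longleftrightarrow> (\<exists>t\<le>k. Q ((step P n m ^^ t) c))"

lemma reaches_now: "Q c \<Longrightarrow> reaches P n m k c Q"
  unfolding reaches_def by (intro exI[of _ 0]) simp

lemma reaches_mono:
  "reaches P n m k c Q \<Longrightarrow> k \<le> l \<Longrightarrow> (\<And>c. Q c \<Longrightarrow> R c) \<Longrightarrow> reaches P n m l c R"
  unfolding reaches_def by (meson le_trans)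

lemma reaches_seq:
  assumes "reaches P n m k c Q" "\<And>c'. Q c' \<Longrightarrow> reaches P n m l c' R"
  shows "reaches P n m (k + l) c R"
proof -
  obtain t u where "t \<le> k" "u \<le> l" "R ((step P n m ^^ u) ((step P n m ^^ t) c))"
    using assms unfolding reaches_def by blast
  then show ?thesis unfolding reaches_def
    by (intro exI[of _ "u + t"]) (auto simp: funpow_add)
qed

lemma reaches_step: "reaches P n m k (step P n m c) Q \<Longrightarrow> reaches P n m (Suc k) c Q"
  unfolding reaches_def by (metis Suc_le_mono comp_apply funpow_Suc_right)

lemma reaches_steps:
  "reaches P n m k (step P n m (step P n m c)) Q \<Longrightarrow> reaches P n m (k + 2) c Q"
  "reaches P n m k (step P n m (step P n m (step P n m c))) Q \<Longrightarrow> reaches P n m (k + 3) c Q"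
  "reaches P n m k (step P n m (step P n m (step P n m (step P n m c)))) Q \<Longrightarrow>
    reaches P n m (k + 4) c Q"
  "reaches P n m k (step P n m (step P n m (step P n m (step P n m (step P n m c))))) Q \<Longrightarrow>
    reaches P n m (k + 5) c Q"
  by (simp_all add: eval_nat_numeral reaches_step)

text \<open>
  The invariant \<open>I i\<close> also fixes the program counter, and \<open>F\<close> stands for an early exit.
\<close>

lemma reaches_loop:
  assumes body: "\<And>i c. i < N \<Longrightarrow> I i c \<Longrightarrow> reaches P n m k c (\<lambda>c'. F c' \<or> I (Suc i) c')"
    and start: "I 0 c"
  shows "reaches P n m (N * k) c (\<lambda>c'. F c' \<or> I N c')"
proof -
  have "i \<le> N \<Longrightarrow> reaches P n m (i * k) c (\<lambda>c'. F c' \<or> I i c')" for i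
  proof (induction i)
    case 0
    then show ?case using start by (intro reaches_now) simp
  next
    case (Suc i)
    then have "reaches P n m (i * k) c (\<lambda>c'. F c' \<or> I i c')" by simp
    then have "reaches P n m (i * k + k) c (\<lambda>c'. F c' \<or> I (Suc i) c')"
      by (rule reaches_seq) (use body Suc reaches_now in auto)
    then show ?case by (simp add: add.commute)
  qed
  then show ?thesis by simp
qed

section \<open>The decision program\<close>

text \<open>
  Registers 0 to 3 hold \<open>n, x, y, z\<close>; registers 4 and 9 hold the constants \<open>1\<close> and \<open>0\<close>; registers 5 to 8 are
  temporary. The mark of the element \<open>w\<close> is at address \<open>w + 10\<close>. The lines are, in this order: initialisation
  with the starts of the two inner loops; the four laws in \<open>loop_laws\<close>; marking \<open>q = z z\<close>; if \<open>y\<close> is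
  marked, testing $w^2 = w^3$ for \<open>w = y q\<close> and marking \<open>w\<close>; the ends of the loops over \<open>z\<close>, \<open>y\<close> and
  \<open>x\<close>. The loops test their condition at the end, as \<open>n > 0\<close>.
\<close>

definition ac2_program :: "instr list" where
  "ac2_program = [
    Const 4 1,
    Const 2 0,
    Const 3 0,
    Product 5 1 2, Product 6 5 1, Product 7 5 5, Product 7 7 6, Jump_Eq 7 6 9, Reject,
    Product 7 1 6, Product 8 6 1, Jump_Eq 7 8 13, Reject,
    Product 7 3 1, Product 7 6 7, Product 8 1 3, Product 8 8 6, Jump_Eq 7 8 19, Reject,
    Product 5 3 3, Product 6 5 5, Jump_Eq 6 5 23, Reject,
    Add_Const 6 5 10, Store 6 4,
    Add_Const 6 2 10, Load 7 6, Jump_Eq 7 9 35,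
    Product 5 2 5, Product 6 5 5, Product 7 6 5, Jump_Eq 7 6 33, Reject,
    Add_Const 6 5 10, Store 6 4,
    Add_Const 3 3 1, Jump_Less 3 0 3,
    Add_Const 2 2 1, Jump_Less 2 0 2,
    Add_Const 1 1 1, Jump_Less 1 0 1,
    Accept]"

lemma length_ac2_program: "length ac2_program = 42"
  by (simp add: ac2_program_def)

lemmas execute = step_def length_ac2_program ac2_program_def

definition marked :: "nat \<Rightarrow> (nat \<Rightarrow> nat) \<Rightarrow> nat set" where
  "marked n X = {w. w < n \<and> X (w + 10) \<noteq> 0}"

text \<open>
  Only elements that pass the test for products of squares are ever marked. A square passes it as
  soon as $z^4 = z^2$ has been tested.
\<close>

definition registers ::
    "nat \<Rightarrow> (nat \<Rightarrow> nat \<Rightarrow> nat) \<Rightarrow> nat \<Rightarrow> nat \<Rightarrow> nat \<Rightarrow> (nat \<Rightarrow> nat) \<Rightarrow> bool" where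
  "registers n m x y z X \<longleftrightarrow> X 0 = n \<and> X 1 = x \<and> X 2 = y \<and> X 3 = z \<and> X 4 = 1 \<and> X 9 = 0 \<and>
     (\<forall>w\<in>marked n X. w \<in> square_products {..<n} m \<and> m (m w w) w = m w w)"

text \<open>
  Reaching \<open>Reject\<close> together with the fact that this answer is correct.
\<close>

definition rejected :: "nat \<Rightarrow> (nat \<Rightarrow> nat \<Rightarrow> nat) \<Rightarrow> config \<Rightarrow> bool" where
  "rejected n m c \<longleftrightarrow> fst c < 42 \<and> ac2_program ! fst c = Reject \<and> \<not> ac2_criterion {..<n} m"

lemma marked_temporary [simp]: "i < 10 \<Longrightarrow> marked n (X(i := v)) = marked n X"
  by (auto simp: marked_def)

lemma marked_mark: "w < n \<Longrightarrow> 0 < v \<Longrightarrow> marked n (X(w + 10 := v)) = insert w (marked n X)"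
  by (auto simp: marked_def)

lemma body_correct:
  assumes S: "semigroup_on {..<n} m" and xyz: "x < n" "y < n" "z < n"
    and X: "registers n m x y z X"
  shows "reaches ac2_program n m 32 (3, X) (\<lambda>c. rejected n m c \<or>
    (\<exists>X'. c = (35, X') \<and> registers n m x y z X' \<and> loop_laws m x y z \<and> marked n X \<subseteq> marked n X' \<and>
      m z z \<in> marked n X' \<and> (y \<in> marked n X \<longrightarrow> m y (m z z) \<in> marked n X')))"
    (is "reaches _ _ _ _ _ ?Q")
proof -
  have cl: "m u v < n" if "u < n" "v < n" for u v using S that by (auto simp: semigroup_on_def)
  have R: "X 0 = n" "X 1 = x" "X (Suc 0) = x" "X 2 = y" "X 3 = z" "X 4 = 1" "X 9 = 0"
    using X by (auto simp: registers_def)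
  define p where "p = m (m x y) x"
  have p: "p < n" using xyz cl by (simp add: p_def)
  let ?s = "step ac2_program n m"
  have reject: "?Q c" if "c = (i, Y)" "i \<in> {8, 12, 18, 22, 32}" "\<not> ac2_criterion {..<n} m" for c i Y
    using that by (auto simp: rejected_def ac2_program_def)
  have laws: "loop_laws m x y z" if "ac2_criterion {..<n} m"
    using that xyz by (simp add: ac2_criterion_def)
  define X1 where "X1 = X(5 := m x y, 6 := p, 7 := m (m (m x y) (m x y)) p)"
  have 1: "?s (?s (?s (?s (?s (3, X))))) = (if m (m (m x y) (m x y)) p = p then 9 else 8, X1)"
    using xyz cl R by (simp add: execute p_def X1_def)
  define X2 where "X2 = X1(7 := m x p, 8 := m p x)"
  have 2: "?s (?s (?s (9, X1))) = (if m x p = m p x then 13 else 12, X2)"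
    using xyz cl R p by (simp add: execute X1_def X2_def)
  define X3 where "X3 = X2(7 := m p (m z x), 8 := m (m x z) p)"
  have 3: "?s (?s (?s (?s (?s (13, X2))))) = (if m p (m z x) = m (m x z) p then 19 else 18, X3)"
    using xyz cl R p by (simp add: execute X1_def X2_def X3_def)
  define q where "q = m z z"
  have q: "q < n" "q \<in> square_products {..<n} m"
    using xyz cl by (auto simp: q_def intro: square_products.square)
  define X4 where "X4 = X3(5 := q, 6 := m q q)"
  have 4: "?s (?s (?s (19, X3))) = (if m q q = q then 23 else 22, X4)"
    using xyz cl R q(1) by (simp add: execute X1_def X2_def X3_def X4_def q_def)
  define X5 where "X5 = X4(6 := q + 10, q + 10 := 1, 6 := y + 10, 7 := (if y = q then 1 else X (y + 10)))"
  have 5: "?s (?s (?s (?s (?s (23, X4))))) = (if X5 7 = 0 then 35 else 28, X5)"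
    using R by (simp add: execute X1_def X2_def X3_def X4_def X5_def)
  define w where "w = m y q"
  have w: "w < n" using xyz q cl by (simp add: w_def)
  define X6 where "X6 = X5(5 := w, 6 := m w w, 7 := m (m w w) w)"
  have 6: "?s (?s (?s (?s (28, X5)))) = (if m (m w w) w = m w w then 33 else 32, X6)"
    using xyz cl R q(1) w by (simp add: execute X1_def X2_def X3_def X4_def X5_def X6_def w_def)
  define X7 where "X7 = X6(6 := w + 10, w + 10 := 1)"
  have 7: "?s (?s (33, X6)) = (35, X7)"
    using R by (simp add: execute X1_def X2_def X3_def X4_def X5_def X6_def X7_def)
  have M5: "marked n X5 = insert q (marked n X)"
    using q by (simp add: X5_def X4_def X3_def X2_def X1_def marked_mark)
  have M7: "marked n X7 = insert w (marked n X5)"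
    using w by (simp add: X6_def X7_def marked_mark)
  have X5_7: "X5 7 \<noteq> 0 \<longleftrightarrow> y \<in> marked n X5"
    using xyz unfolding M5 by (auto simp: X5_def marked_def)
  have inv: "registers n m x y z Y" if "marked n Y = A" "\<forall>w\<in>A. w \<in> square_products {..<n} m \<and> m (m w w) w = m w w"
    "\<forall>i\<in>{0, 1, 2, 3, 4, 9}. Y i = X i" for Y A
    using that X by (auto simp: registers_def)
  have old: "\<forall>w\<in>marked n X. w \<in> square_products {..<n} m \<and> m (m w w) w = m w w"
    using X by (simp add: registers_def)
  have g6: "reaches ac2_program n m 6 (28, X5) ?Q"
    if l: "loop_laws m x y z" and y: "y \<in> marked n X5" "y \<in> square_products {..<n} m"
  proof -
    have w': "w \<in> square_products {..<n} m"
      using y xyz by (simp add: w_def q_def square_products.times_square)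
    have "reaches ac2_program n m 2 (if m (m w w) w = m w w then 33 else 32, X6) ?Q"
    proof (cases "m (m w w) w = m w w")
      case True
      have "registers n m x y z X7"
        by (rule inv[OF M7]) (use True w' M5 old q l in \<open>auto simp: X1_def X2_def X3_def X4_def
          X5_def X6_def X7_def loop_laws_def q_def\<close>)
      then have "?Q (35, X7)" using l M5 M7 by (auto simp: q_def w_def)
      then have "reaches ac2_program n m (0 + 2) (33, X6) ?Q"
        by (intro reaches_steps(1)) (simp only: 7 reaches_now)
      then show ?thesis using True by (simp add: numeral_2_eq_2)
    next
      case False
      then have "\<not> ac2_criterion {..<n} m" using w' by (auto simp: ac2_criterion_def)
      then show ?thesis using False by (intro reaches_now reject) auto
    qed
    then have "reaches ac2_program n m (2 + 4) (28, X5) ?Q"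
      by (intro reaches_steps(3)) (simp only: 6)
    then show ?thesis by simp
  qed
  have g5: "reaches ac2_program n m 11 (23, X4) ?Q" if l: "loop_laws m x y z"
  proof -
    have M5': "\<forall>w\<in>marked n X5. w \<in> square_products {..<n} m \<and> m (m w w) w = m w w"
      using old q l by (auto simp: M5 loop_laws_def q_def)
    have "reaches ac2_program n m 6 (if X5 7 = 0 then 35 else 28, X5) ?Q"
    proof (cases "X5 7 = 0")
      case True
      have "registers n m x y z X5"
        by (rule inv[OF refl M5']) (use q in \<open>auto simp: X1_def X2_def X3_def X4_def X5_def\<close>)
      moreover have "y \<notin> marked n X5" using X5_7 True by simp
      ultimately have "?Q (35, X5)" using l M5 by (auto simp: q_def)
      then show ?thesis using True by (simp add: reaches_now)
    next
      case False
      then show ?thesis using g6[OF l] X5_7 M5' by auto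
    qed
    then have "reaches ac2_program n m (6 + 5) (23, X4) ?Q"
      by (intro reaches_steps(4)) (simp only: 5)
    then show ?thesis by simp
  qed
  have fail: "reaches ac2_program n m k (i, Y) ?Q" if "\<not> loop_laws m x y z" "i \<in> {8, 12, 18, 22}" for k i Y
    using that laws by (intro reaches_now reject) auto
  have "reaches ac2_program n m 11 (if m q q = q then 23 else 22, X4) ?Q"
    if "m (m (m x y) (m x y)) p = p" "m x p = m p x" "m p (m z x) = m (m x z) p"
  proof (cases "m q q = q")
    case True
    then show ?thesis using that g5 by (simp add: loop_laws_def p_def q_def)
  next
    case False
    then show ?thesis using fail[of 22] by (simp add: loop_laws_def q_def)
  qed
  then have g4: "reaches ac2_program n m (11 + 3) (19, X3) ?Q"
    if "m (m (m x y) (m x y)) p = p" "m x p = m p x" "m p (m z x) = m (m x z) p"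
    using that by (intro reaches_steps(2)) (simp only: 4)
  have "reaches ac2_program n m 14 (if m p (m z x) = m (m x z) p then 19 else 18, X3) ?Q"
    if "m (m (m x y) (m x y)) p = p" "m x p = m p x"
  proof (cases "m p (m z x) = m (m x z) p")
    case False
    then show ?thesis using fail[of 18] by (simp add: loop_laws_def p_def)
  qed (use that g4 in simp)
  then have g3: "reaches ac2_program n m (14 + 5) (13, X2) ?Q"
    if "m (m (m x y) (m x y)) p = p" "m x p = m p x"
    using that by (intro reaches_steps(4)) (simp only: 3)
  have "reaches ac2_program n m 19 (if m x p = m p x then 13 else 12, X2) ?Q"
    if "m (m (m x y) (m x y)) p = p"
  proof (cases "m x p = m p x")
    case False
    then show ?thesis using fail[of 12] by (simp add: loop_laws_def p_def)
  qed (use that g3 in simp)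
  then have g2: "reaches ac2_program n m (19 + 3) (9, X1) ?Q" if "m (m (m x y) (m x y)) p = p"
    using that by (intro reaches_steps(2)) (simp only: 2)
  have "reaches ac2_program n m 22 (if m (m (m x y) (m x y)) p = p then 9 else 8, X1) ?Q"
  proof (cases "m (m (m x y) (m x y)) p = p")
    case False
    then show ?thesis using fail[of 8] by (simp add: loop_laws_def p_def)
  qed (use g2 in simp)
  then have "reaches ac2_program n m (22 + 5) (3, X) ?Q"
    by (intro reaches_steps(4)) (simp only: 1)
  then show ?thesis by (rule reaches_mono) auto
qed

lemma loop_over_z:
  assumes S: "semigroup_on {..<n} m" and xy: "x < n" "y < n"
    and X: "registers n m x y 0 X"
  shows "reaches ac2_program n m (n * 34) (3, X) (\<lambda>c. rejected n m c \<or>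
    (\<exists>X'. c = (37, X') \<and> registers n m x y n X' \<and> marked n X \<subseteq> marked n X' \<and>
      (\<forall>z<n. loop_laws m x y z \<and> m z z \<in> marked n X' \<and>
        (y \<in> marked n X \<longrightarrow> m y (m z z) \<in> marked n X'))))"
proof -
  define I where "I z c \<longleftrightarrow> (\<exists>X'. c = (if z < n then 3 else 37, X') \<and> registers n m x y z X' \<and>
    marked n X \<subseteq> marked n X' \<and> (\<forall>z'<z. loop_laws m x y z' \<and> m z' z' \<in> marked n X' \<and>
        (y \<in> marked n X \<longrightarrow> m y (m z' z') \<in> marked n X')))" for z and c :: config
  have "reaches ac2_program n m 34 c (\<lambda>c'. rejected n m c' \<or> I (Suc z) c')"
    if z: "z < n" and I: "I z c" for z and c :: config
  proof -
    obtain X1 where X1: "c = (3, X1)" "registers n m x y z X1" "marked n X \<subseteq> marked n X1"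
      "\<forall>z'<z. loop_laws m x y z' \<and> m z' z' \<in> marked n X1 \<and>
        (y \<in> marked n X \<longrightarrow> m y (m z' z') \<in> marked n X1)"
      using I z by (auto simp: I_def)
    have "reaches ac2_program n m (32 + 2) c (\<lambda>c'. rejected n m c' \<or> I (Suc z) c')"
      unfolding X1(1)
    proof (rule reaches_seq[OF body_correct[OF S xy z X1(2)]], elim disjE exE conjE)
      fix c' :: config and X2
      assume X2: "c' = (35, X2)" "registers n m x y z X2" "loop_laws m x y z" "marked n X1 \<subseteq> marked n X2"
        "m z z \<in> marked n X2" "y \<in> marked n X1 \<longrightarrow> m y (m z z) \<in> marked n X2"
      define X3 where "X3 = X2(3 := Suc z)"
      have "step ac2_program n m (step ac2_program n m c') = (if Suc z < n then 3 else 37, X3)"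
        using X2(1,2) by (simp add: execute registers_def X3_def)
      moreover have "registers n m x y (Suc z) X3" using X2(2) by (simp add: registers_def X3_def)
      moreover have "marked n X3 = marked n X2" by (simp add: X3_def)
      ultimately have "I (Suc z) (step ac2_program n m (step ac2_program n m c'))"
        using X1(3,4) X2(3-6) by (auto simp: I_def less_Suc_eq)
      then have "reaches ac2_program n m (0 + 2) c' (\<lambda>c'. rejected n m c' \<or> I (Suc z) c')"
        by (intro reaches_steps(1) reaches_now) simp
      then show "reaches ac2_program n m 2 c' (\<lambda>c'. rejected n m c' \<or> I (Suc z) c')"
        by (simp add: numeral_2_eq_2)
    qed (simp add: reaches_now)
    then show ?thesis by simp
  qed
  moreover have "I 0 (3, X)" using X xy by (auto simp: I_def)
  ultimately have "reaches ac2_program n m (n * 34) (3, X) (\<lambda>c. rejected n m c \<or> I n c)"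
    by (rule reaches_loop)
  then show ?thesis by (rule reaches_mono) (auto simp: I_def)
qed

lemma loop_over_y:
  assumes S: "semigroup_on {..<n} m" and x: "x < n"
    and X: "registers n m x 0 z X"
  shows "reaches ac2_program n m (n * (n * 34 + 3)) (2, X) (\<lambda>c. rejected n m c \<or>
    (\<exists>X' z'. c = (39, X') \<and> registers n m x n z' X' \<and> marked n X \<subseteq> marked n X' \<and>
      (\<forall>y<n. \<forall>z<n. loop_laws m x y z \<and> m z z \<in> marked n X' \<and>
        (y \<in> marked n X \<longrightarrow> m y (m z z) \<in> marked n X'))))"
proof -
  define I where "I y c \<longleftrightarrow> (\<exists>X' z'. c = (if y < n then 2 else 39, X') \<and> registers n m x y z' X' \<and>
    marked n X \<subseteq> marked n X' \<and> (\<forall>y'<y. \<forall>z<n. loop_laws m x y' z \<and> m z z \<in> marked n X' \<and>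
        (y' \<in> marked n X \<longrightarrow> m y' (m z z) \<in> marked n X')))" for y and c :: config
  have "reaches ac2_program n m (n * 34 + 3) c (\<lambda>c'. rejected n m c' \<or> I (Suc y) c')"
    if y: "y < n" and I: "I y c" for y and c :: config
  proof -
    obtain X1 z1 where X1: "c = (2, X1)" "registers n m x y z1 X1" "marked n X \<subseteq> marked n X1"
      "\<forall>y'<y. \<forall>z<n. loop_laws m x y' z \<and> m z z \<in> marked n X1 \<and>
        (y' \<in> marked n X \<longrightarrow> m y' (m z z) \<in> marked n X1)"
      using I y by (auto simp: I_def)
    define X2 where "X2 = X1(3 := 0)"
    have step: "step ac2_program n m c = (3, X2)" by (simp add: execute X1(1) X2_def)
    have X2: "registers n m x y 0 X2" "marked n X2 = marked n X1"
      using X1(2) by (simp_all add: registers_def X2_def)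
    have "reaches ac2_program n m (n * 34 + 2) (3, X2) (\<lambda>c'. rejected n m c' \<or> I (Suc y) c')"
    proof (rule reaches_seq[OF loop_over_z[OF S x y X2(1)]], elim disjE exE conjE)
      fix c' :: config and X3
      assume X3: "c' = (37, X3)" "registers n m x y n X3" "marked n X2 \<subseteq> marked n X3"
        "\<forall>z<n. loop_laws m x y z \<and> m z z \<in> marked n X3 \<and>
          (y \<in> marked n X2 \<longrightarrow> m y (m z z) \<in> marked n X3)"
      define X4 where "X4 = X3(2 := Suc y)"
      have "step ac2_program n m (step ac2_program n m c') = (if Suc y < n then 2 else 39, X4)"
        using X3(1,2) by (simp add: execute registers_def X4_def)
      moreover have "registers n m x (Suc y) n X4" using X3(2) by (simp add: registers_def X4_def)
      moreover have "marked n X4 = marked n X3" by (simp add: X4_def)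
      moreover have "\<forall>y'<Suc y. \<forall>z<n. loop_laws m x y' z \<and> m z z \<in> marked n X3 \<and>
        (y' \<in> marked n X \<longrightarrow> m y' (m z z) \<in> marked n X3)"
        using X1(3,4) X2(2) X3(3,4) by (auto simp: less_Suc_eq)
      ultimately have "I (Suc y) (step ac2_program n m (step ac2_program n m c'))"
        using X1(3) X2(2) X3(3) unfolding I_def by fastforce
      then have "reaches ac2_program n m (0 + 2) c' (\<lambda>c'. rejected n m c' \<or> I (Suc y) c')"
        by (intro reaches_steps(1) reaches_now) simp
      then show "reaches ac2_program n m 2 c' (\<lambda>c'. rejected n m c' \<or> I (Suc y) c')"
        by (simp add: numeral_2_eq_2)
    qed (simp add: reaches_now)
    then have "reaches ac2_program n m (Suc (n * 34 + 2)) c (\<lambda>c'. rejected n m c' \<or> I (Suc y) c')"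
      by (intro reaches_step) (simp only: step)
    then show ?thesis by (rule reaches_mono) (linarith, assumption)
  qed
  moreover have "I 0 (2, X)" using X x by (auto simp: I_def)
  ultimately have "reaches ac2_program n m (n * (n * 34 + 3)) (2, X) (\<lambda>c. rejected n m c \<or> I n c)"
    by (rule reaches_loop)
  then show ?thesis by (rule reaches_mono) (auto simp: I_def)
qed

text \<open>
  A round either marks a new element or finds the marked set closed, in which case it contains all
  products of squares. The latter persists, hence the count of rounds is a lower bound for the number of
  marked elements until saturation.
\<close>

lemma marking_round:
  assumes "finite M'" "M \<subseteq> M'" "M' \<subseteq> square_products S f"
    and closure: "\<And>z. z \<in> S \<Longrightarrow> f z z \<in> M'" "\<And>y z. y \<in> M \<Longrightarrow> z \<in> S \<Longrightarrow> f y (f z z) \<in> M'"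
    and progress: "square_products S f \<subseteq> M \<or> k \<le> card M"
  shows "square_products S f \<subseteq> M' \<or> Suc k \<le> card M'"
proof (cases "M' = M")
  case True
  have "w \<in> M" if "w \<in> square_products S f" for w
    using that closure unfolding True by induction auto
  then show ?thesis using True by blast
next
  case False
  then have "card M < card M'" using assms(1,2) by (intro psubset_card_mono) auto
  then show ?thesis using progress assms(2) by auto
qed

lemma loop_over_x:
  assumes S: "semigroup_on {..<n} m" and n: "0 < n" and X: "registers n m 0 0 0 X"
  shows "reaches ac2_program n m (n * (n * (n * 34 + 3) + 3)) (1, X)
    (\<lambda>c. rejected n m c \<or> fst c = 41 \<and> ac2_criterion {..<n} m)"
proof -
  define I where "I x c \<longleftrightarrow> (\<exists>X' y' z'. c = (if x < n then 1 else 41, X') \<and> registers n m x y' z' X' \<and>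
    (\<forall>x'<x. \<forall>y<n. \<forall>z<n. loop_laws m x' y z) \<and>
    (square_products {..<n} m \<subseteq> marked n X' \<or> x \<le> card (marked n X')))" for x and c :: config
  have marked: "marked n Y \<subseteq> {..<n}" "finite (marked n Y)" for Y
    by (auto simp: marked_def)
  have "reaches ac2_program n m (n * (n * 34 + 3) + 3) c (\<lambda>c'. rejected n m c' \<or> I (Suc x) c')"
    if x: "x < n" and I: "I x c" for x and c :: config
  proof -
    obtain X1 y1 z1 where X1: "c = (1, X1)" "registers n m x y1 z1 X1"
      "\<forall>x'<x. \<forall>y<n. \<forall>z<n. loop_laws m x' y z"
      "square_products {..<n} m \<subseteq> marked n X1 \<or> x \<le> card (marked n X1)"
      using I x by (auto simp: I_def)
    define X2 where "X2 = X1(2 := 0)"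
    have step: "step ac2_program n m c = (2, X2)" by (simp add: execute X1(1) X2_def)
    have X2: "registers n m x 0 z1 X2" "marked n X2 = marked n X1"
      using X1(2) by (simp_all add: registers_def X2_def)
    have "reaches ac2_program n m (n * (n * 34 + 3) + 2) (2, X2) (\<lambda>c'. rejected n m c' \<or> I (Suc x) c')"
    proof (rule reaches_seq[OF loop_over_y[OF S x X2(1)]], elim disjE exE conjE)
      fix c' :: config and X3 z3
      assume X3: "c' = (39, X3)" "registers n m x n z3 X3" "marked n X2 \<subseteq> marked n X3"
        "\<forall>y<n. \<forall>z<n. loop_laws m x y z \<and> m z z \<in> marked n X3 \<and>
          (y \<in> marked n X2 \<longrightarrow> m y (m z z) \<in> marked n X3)"
      define X4 where "X4 = X3(1 := Suc x)"
      have "step ac2_program n m (step ac2_program n m c') = (if Suc x < n then 1 else 41, X4)"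
        using X3(1,2) by (simp add: execute registers_def X4_def)
      moreover have "registers n m (Suc x) n z3 X4" using X3(2) by (simp add: registers_def X4_def)
      moreover have "marked n X4 = marked n X3" by (simp add: X4_def)
      moreover have "square_products {..<n} m \<subseteq> marked n X3 \<or> Suc x \<le> card (marked n X3)"
      proof (rule marking_round)
        show "marked n X3 \<subseteq> square_products {..<n} m" using X3(2) by (auto simp: registers_def)
        show "m y (m z z) \<in> marked n X3" if "y \<in> marked n X1" "z \<in> {..<n}" for y z
          using that X2(2) X3(4) marked(1)[of X1] by auto
      qed (use X1(4) X2(2) X3(3,4) marked n in auto)
      moreover have "\<forall>x'<Suc x. \<forall>y<n. \<forall>z<n. loop_laws m x' y z"
        using X1(3) X3(4) by (auto simp: less_Suc_eq)
      ultimately have "I (Suc x) (step ac2_program n m (step ac2_program n m c'))"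
        unfolding I_def by auto
      then have "reaches ac2_program n m (0 + 2) c' (\<lambda>c'. rejected n m c' \<or> I (Suc x) c')"
        by (intro reaches_steps(1) reaches_now) simp
      then show "reaches ac2_program n m 2 c' (\<lambda>c'. rejected n m c' \<or> I (Suc x) c')"
        by (simp add: numeral_2_eq_2)
    qed (simp add: reaches_now)
    then have "reaches ac2_program n m (Suc (n * (n * 34 + 3) + 2)) c (\<lambda>c'. rejected n m c' \<or> I (Suc x) c')"
      by (intro reaches_step) (simp only: step)
    then show ?thesis by (rule reaches_mono) (linarith, assumption)
  qed
  moreover have "I 0 (1, X)" using X n by (auto simp: I_def)
  ultimately have "reaches ac2_program n m (n * (n * (n * 34 + 3) + 3)) (1, X) (\<lambda>c. rejected n m c \<or> I n c)"
    by (rule reaches_loop)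
  then show ?thesis
  proof (rule reaches_mono)
    fix c assume "rejected n m c \<or> I n c"
    then show "rejected n m c \<or> fst c = 41 \<and> ac2_criterion {..<n} m"
    proof
      assume "I n c"
      then obtain X' y' z' where X': "c = (41, X')" "registers n m n y' z' X'"
        "\<forall>x<n. \<forall>y<n. \<forall>z<n. loop_laws m x y z"
        "square_products {..<n} m \<subseteq> marked n X' \<or> n \<le> card (marked n X')"
        by (auto simp: I_def)
      \<comment> \<open>After \<open>n\<close> rounds without saturation all elements are marked.\<close>
      have "n \<le> card (marked n X') \<Longrightarrow> marked n X' = {..<n}"
        using card_seteq[OF finite_lessThan marked(1)[of X']] by simp
      then have "square_products {..<n} m \<subseteq> marked n X'"
        using X'(4) square_products_subset[OF S] by auto
      then have "ac2_criterion {..<n} m"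
        using X'(2,3) by (auto simp: ac2_criterion_def registers_def)
      then show ?thesis using X'(1) by simp
    qed simp
  qed simp
qed

lemma cubic_bound:
  assumes "0 < n"
  shows "Suc (n * (n * (n * 34 + 3) + 3)) \<le> 41 * n ^ 3"
proof -
  have "n \<le> n ^ 3" "n ^ 2 \<le> n ^ 3" "1 \<le> n ^ 3"
    using assms by (auto simp: power_increasing self_le_power)
  moreover have "n * (n * (n * 34 + 3) + 3) = 34 * n ^ 3 + 3 * n ^ 2 + 3 * n"
    by (simp add: algebra_simps power2_eq_square power3_eq_cube)
  ultimately show ?thesis by linarith
qed

lemma ac2_program_answers:
  assumes S: "semigroup_on {..<n} m"
  shows "answers_within ac2_program n m (41 * n ^ 3) (in_variety {..<n} m (UNIV :: ac2 set) ac2_mult)"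
proof -
  have n: "0 < n" using S by (auto simp: semigroup_on_def)
  let ?X = "(\<lambda>_. 0)(0 := n)"
  let ?Q = "\<lambda>c. rejected n m c \<or> fst c = 41 \<and> ac2_criterion {..<n} m"
  have "step ac2_program n m (0, ?X) = (1, ?X(4 := 1))" by (simp add: execute)
  moreover have "registers n m 0 0 0 (?X(4 := 1))" by (simp add: registers_def marked_def)
  ultimately have "reaches ac2_program n m (Suc (n * (n * (n * 34 + 3) + 3))) (0, ?X) ?Q"
    using loop_over_x[OF S n] by (intro reaches_step) simp
  then have "reaches ac2_program n m (41 * n ^ 3) (0, ?X) ?Q"
    using cubic_bound[OF n] by (rule reaches_mono)
  then obtain t where "t \<le> 41 * n ^ 3" "?Q (run ac2_program n m t)"
    by (auto simp: reaches_def run_def)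
  then show ?thesis unfolding answers_within_def in_variety_ac2_iff[OF S]
    by (intro exI[of _ t]) (auto simp: rejected_def ac2_program_def)
qed

text \<open>
  No instruction of the program adds two registers. So a step increases the largest content by at most
  the constant 10, and the time bound also bounds the contents; after halting nothing changes.
\<close>

lemma registers_grow_slowly:
  assumes S: "semigroup_on {..<n} m" and X: "\<And>i. snd c i \<le> B" and n: "n \<le> B"
  shows "snd (step ac2_program n m c) i \<le> B + 10"
proof (cases "fst c < 42")
  case True
  have m: "m u v \<le> B" if "u < n" "v < n" for u v
  proof -
    have "m u v \<in> {..<n}" using S that by (simp add: semigroup_on_def)
    then show ?thesis using n by simp
  qed
  obtain pc Y where c: "c = (pc, Y)" by (cases c)
  have Y: "Y j \<le> 9 + B" "Y j \<le> B" for j using X[of j] by (simp_all add: c)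
  have "ac2_program ! pc \<in> set ac2_program" using True c by (simp add: length_ac2_program)
  moreover have "snd (exec_instr n m I (pc, Y)) i \<le> B + 10" if "I \<in> set ac2_program" for I
    using that Y m by (auto simp: ac2_program_def trans_le_add1)
  ultimately show ?thesis using True by (simp add: c step_def length_ac2_program)
next
  case False
  then show ?thesis using X[of i] by (simp add: step_def length_ac2_program)
qed

lemma ac2_program_short_words: "short_words ac2_program"
proof -
  have "snd (run ac2_program n m t) i \<le> 411 * n ^ 411" if S: "semigroup_on {..<n} m" for n m t i
  proof -
    have n: "0 < n" using S by (auto simp: semigroup_on_def)
    have grow: "snd (run ac2_program n m t) i \<le> n + 10 * t" for t i
    proof (induction t arbitrary: i)
      case 0
      then show ?case by (simp add: run_def)
    next
      case (Suc t)
      then show ?case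
        using registers_grow_slowly[OF S, of "run ac2_program n m t" "n + 10 * t" i] by (simp add: run_def)
    qed
    obtain t0 where t0: "t0 \<le> 41 * n ^ 3" "fst (run ac2_program n m t0) < 42"
      "ac2_program ! fst (run ac2_program n m t0) \<in> {Accept, Reject}"
      using ac2_program_answers[OF S] by (auto simp: answers_within_def length_ac2_program split: if_splits)
    have halt: "run ac2_program n m (t0 + k) = run ac2_program n m t0" for k
    proof (induction k)
      case (Suc k)
      have "run ac2_program n m (t0 + Suc k) = step ac2_program n m (run ac2_program n m t0)"
        using Suc by (simp add: run_def)
      also have "\<dots> = run ac2_program n m t0"
        using t0(2,3) by (cases "run ac2_program n m t0") (auto simp: step_def)
      finally show ?case .
    qed simp
    have "snd (run ac2_program n m t) i \<le> n + 10 * (41 * n ^ 3)"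
    proof (cases "t \<le> t0")
      case True
      then show ?thesis using grow[of t i] t0(1) by linarith
    next
      case False
      then have "run ac2_program n m t = run ac2_program n m t0" using halt[of "t - t0"] by simp
      then show ?thesis using grow[of t0 i] t0(1) by simp
    qed
    moreover have "n \<le> n ^ 411" "n ^ 3 \<le> n ^ 411"
      using n by (auto intro: power_increasing self_le_power)
    ultimately show ?thesis by linarith
  qed
  then show ?thesis unfolding short_words_def by blast
qed

theorem theorem2:
  shows "\<not> finitely_based (UNIV :: ac2 set) ac2_mult \<and>
    (\<exists>P T. (\<lambda>n. real (T n)) \<in> O(\<lambda>n. real n ^ 3) \<and>
       decides_membership P (UNIV :: ac2 set) ac2_mult T)"
proof
  show "\<not> finitely_based (UNIV :: ac2 set) ac2_mult" by (rule ac2_not_finitely_based)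
  have "(\<lambda>n. real (41 * n ^ 3)) \<in> O(\<lambda>n. real n ^ 3)" by simp
  moreover have "decides_membership ac2_program (UNIV :: ac2 set) ac2_mult (\<lambda>n. 41 * n ^ 3)"
    using ac2_program_short_words ac2_program_answers by (simp add: decides_membership_def)
  ultimately show "\<exists>P T. (\<lambda>n. real (T n)) \<in> O(\<lambda>n. real n ^ 3) \<and>
      decides_membership P (UNIV :: ac2 set) ac2_mult T"
    by (intro exI[of _ ac2_program] exI[of _ "\<lambda>n. 41 * n ^ 3"] conjI)
qed

end
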